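(* Let $\psi\in \mathcal{O}_M(\mathbb{R})$ be a real-valued, surjective function $\psi:\mathbb{R}\to\mathbb{R}$. Then the following conditions are equivalent. (i) The operator $C_\psi\colon\mathcal{O}_M(\mathbb{R})\to \mathcal{O}_M(\mathbb{R})$, $f\mapsto f \circ \psi$, is mixing. (ii) $\psi$ is injective with $\psi'(x)\neq 0$ for all $x\in\mathbb{R}$ and without fixed points, and for every $a\in\mathbb{R}$, each $k\in\mathbb{N}$ and every $v\in \mathcal{S}(\mathbb{R})$ it holds $$\lim_{n\to\infty} \sup_{x\in\psi_{-n}\left([\min\{a,\psi(a)\},\max\{a,\psi(a)\}]\right)}\left|v(x)(\psi_n)^{(k)}(x)\right|=0$$ and $$\lim_{n\to\infty} \sup_{x\in\psi_{n}\left([\min\{a,\psi(a)\},\max\{a,\psi(a)\}]\right)}\left|v(x)(\psi_{-n})^{(k)}(x)\right|=0.$$ (iii) $\psi$ is injective with $\psi'(x)\neq 0$ for all $x\in\mathbb{R}$ and without fixed points, and there are $a,b\in\mathbb{R}$ such that for every $k\in\mathbb{N}$ and every $v\in \mathcal{S}(\mathbb{R})$ we have $$\lim_{n\to\infty} \sup_{x\in\psi_{-n}\left([\min\{a,\psi(a)\},\max\{a,\psi(a)\}]\right)}\left|v(x)(\psi_n)^{(k)}(x)\right|=0$$ and $$\lim_{n\to\infty} \sup_{x\in\psi_{n}\left([\min\{b,\psi(b)\},\max\{b,\psi(b)\}]\right)}\left|v(x)(\psi_{-n})^{(k)}(x)\right|=0.$$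
   Context: $\mathbb{N}=\{1,2,3,\ldots\}$. $\mathcal{S}(\mathbb{R})$ is the Schwartz space of rapidly decreasing smooth functions. For $m,n\in\mathbb{N}$ let $\mathcal{O}_n^m(\mathbb{R})=\{f\in C^m(\mathbb{R}): |f|_{m,n}:=\sup_{x\in\mathbb{R},\,0\le j\le m}(1+|x|^2)^{-n}|f^{(j)}(x)|<\infty\}$, a Banach space under $|\cdot|_{m,n}$, and $\mathcal{O}_M(\mathbb{R})=\bigcap_{m=1}^\infty\bigcup_{n=1}^\infty\mathcal{O}_n^m(\mathbb{R})$ (slowly increasing smooth functions, the multipliers of $\mathcal{S}(\mathbb{R})$). It carries the locally convex topology of the projective limit over $m$ of the (LB)-spaces $\operatorname{ind}_{n\to\infty}\mathcal{O}_n^m(\mathbb{R})$; equivalently, the topology given by the seminorms $p_{m,v}(f)=\sup_{x\in\mathbb{R}}\max_{0\le j\le m}|v(x)f^{(j)}(x)|$, $m\ge 0$, $v\in\mathcal{S}(\mathbb{R})$. For a smooth $\psi:\mathbb{R}\to\mathbb{R}$, the operator $C_\psi$ is well defined (and then continuous) on $\mathcal{O}_M(\mathbb{R})$ if and only if $\psi\in\mathcal{O}_M(\mathbb{R})$. Iterates: $\psi_0(x)=x$, $\psi_n=\psi\circ\psi_{n-1}$ for $n\in\mathbb{N}$; for injective $\psi$ and $n\in\mathbb{N}$, $\psi_{-n}:\psi_n(\mathbb{R})\to\mathbb{R}$ is the inverse of $\psi_n$. $(\psi_n)^{(k)}$ denotes the $k$-th derivative of $\psi_n$. A continuous linear operator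 $T$ on a topological vector space $E$ is mixing if for every pair of non-empty open sets $U,V\subseteq E$ one has $T^n(U)\cap V\neq\emptyset$ for all sufficiently large $n\in\mathbb{N}$. *)

theory Defs
  imports "HOL-Analysis.Analysis"
begin

primrec nderiv :: "nat \<Rightarrow> (real \<Rightarrow> 'a::real_normed_vector) \<Rightarrow> real \<Rightarrow> 'a" where
  "nderiv 0 f = f"
| "nderiv (Suc k) f = (\<lambda>x. vector_derivative (nderiv k f) (at x))"

definition C_diff :: "nat \<Rightarrow> (real \<Rightarrow> 'a::real_normed_vector) set" where
  "C_diff m = {f. (\<forall>j<m. \<forall>x. nderiv j f differentiable (at x)) \<and> continuous_on UNIV (nderiv m f)}"

definition schwartz :: "(real \<Rightarrow> complex) set" where
  "schwartz = {v. (\<forall>m. v \<in> C_diff m) \<and>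
     (\<forall>k l. bdd_above (range (\<lambda>x. \<bar>x\<bar> ^ k * norm (nderiv l v x))))}"

text \<open>The supremum of a nonempty set of reals is finite iff the set is bounded above, which is how
  finiteness of the weighted norm is expressed here. The codomain is left general so that the same
  definition covers complex-valued functions and real-valued symbols.\<close>

definition O_mn :: "nat \<Rightarrow> nat \<Rightarrow> (real \<Rightarrow> 'a::real_normed_vector) set" where
  "O_mn m n = {f \<in> C_diff m.
     bdd_above ((\<lambda>(x, j). (1 + \<bar>x\<bar>\<^sup>2) powi (- int n) * norm (nderiv j f x)) ` (UNIV \<times> {0..m}))}"

definition O_M :: "(real \<Rightarrow> 'a::real_normed_vector) set" where
  "O_M = (\<Inter>m\<in>{1..}. \<Union>n\<in>{1..}. O_mn m n)"

text \<open>The supremum below is finite for \<open>v\<close> in the Schwartz space and \<open>f\<close> in \<open>O_M\<close>,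
  the only case in which it is used.\<close>

definition OM_seminorm :: "nat \<Rightarrow> (real \<Rightarrow> complex) \<Rightarrow> (real \<Rightarrow> complex) \<Rightarrow> real" where
  "OM_seminorm m v f = (SUP x. MAX j\<in>{0..m}. norm (v x * nderiv j f x))"

text \<open>The locally convex topology of the family of seminorms: open seminorm balls around all
  points of \<open>O_M\<close> form a subbasis.\<close>

definition OM_topology :: "(real \<Rightarrow> complex) topology" where
  "OM_topology = topology_generated_by
     {{g \<in> O_M. OM_seminorm m v (\<lambda>x. g x - f x) < \<epsilon>} | m v f \<epsilon>. v \<in> schwartz \<and> f \<in> O_M \<and> \<epsilon> > 0}"

lemma nderiv_zero: "nderiv k (\<lambda>x. 0) = (\<lambda>x. 0)"
  by (induction k) auto

lemma topspace_OM_topology: "topspace OM_topology = O_M"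
proof
  show "topspace OM_topology \<subseteq> O_M"
    unfolding OM_topology_def topology_generated_by_topspace by blast
next
  have z: "(\<lambda>x. 0) \<in> schwartz"
    by (auto simp: schwartz_def C_diff_def nderiv_zero)
  show "O_M \<subseteq> topspace OM_topology"
  proof
    fix f :: "real \<Rightarrow> complex"
    assume f: "f \<in> O_M"
    let ?B = "{g \<in> O_M. OM_seminorm 0 (\<lambda>x. 0) (\<lambda>x. g x - f x) < 1}"
    have "f \<in> ?B"
      using f by (simp add: OM_seminorm_def)
    moreover have "openin OM_topology ?B"
      unfolding OM_topology_def
      by (rule topology_generated_by_Basis, rule CollectI, intro exI conjI, rule refl)
        (use z f in simp_all)
    ultimately show "f \<in> topspace OM_topology"
      using openin_subset by blast
  qed
qed

definition continuous_linear_operator ::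
  "('a \<Rightarrow> complex) topology \<Rightarrow> (('a \<Rightarrow> complex) \<Rightarrow> ('a \<Rightarrow> complex)) \<Rightarrow> bool" where
  "continuous_linear_operator E T \<longleftrightarrow> continuous_map E E T \<and>
     (\<forall>f\<in>topspace E. \<forall>g\<in>topspace E. T (\<lambda>x. f x + g x) = (\<lambda>x. T f x + T g x)) \<and>
     (\<forall>c. \<forall>f\<in>topspace E. T (\<lambda>x. c * f x) = (\<lambda>x. c * T f x))"

definition mixing ::
  "('a \<Rightarrow> complex) topology \<Rightarrow> (('a \<Rightarrow> complex) \<Rightarrow> ('a \<Rightarrow> complex)) \<Rightarrow> bool" where
  "mixing E T \<longleftrightarrow> continuous_linear_operator E T \<and>
     (\<forall>U V. openin E U \<and> U \<noteq> {} \<and> openin E V \<and> V \<noteq> {} \<longrightarrow>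
        (\<forall>\<^sub>F n in sequentially. (T ^^ n) ` U \<inter> V \<noteq> {}))"

definition comp_op :: "(real \<Rightarrow> real) \<Rightarrow> (real \<Rightarrow> complex) \<Rightarrow> (real \<Rightarrow> complex)" where
  "comp_op \<psi> f = f \<circ> \<psi>"

text \<open>For bijective \<open>\<psi>\<close> this is the two-sided inverse of the \<open>n\<close>-th iterate, defined on all reals.\<close>

definition inv_iterate :: "(real \<Rightarrow> real) \<Rightarrow> nat \<Rightarrow> real \<Rightarrow> real" where
  "inv_iterate \<psi> n = inv (\<psi> ^^ n)"

end

theory Submission
  imports Defs
begin

text \<open>
  The key observation is that, along sets \<open>A\<^sub>n\<close> escaping to infinity, \<open>v \<cdot> q\<^sub>n \<rightarrow> 0\<close> uniformly on \<open>A\<^sub>n\<close>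
  for every Schwartz function \<open>v\<close> iff the \<open>q\<^sub>n\<close> satisfy one polynomial bound on \<open>A\<^sub>n\<close> for all large \<open>n\<close>.
  Polynomial bounds are stable under sums, products and (by the chain rule) compositions.
  Hence the bounds for the derivatives of the iterates on the fundamental domain between \<open>a\<close> and \<open>\<psi> a\<close>
  spread to all compact sets, and for compactly supported \<open>f\<close> and \<open>g\<close> both \<open>f \<circ> \<psi>\<^sup>n\<close> and
  \<open>g \<circ> \<psi>\<^sup>-\<^sup>n\<close> tend to \<open>0\<close>. As such functions are dense, \<open>f + g \<circ> \<psi>\<^sup>-\<^sup>n\<close> witnesses mixing.
  Conversely, mixing provides functions \<open>H\<^sub>n\<close> close to the identity on a compact set with
  \<open>H\<^sub>n \<circ> \<psi>\<^sup>n\<close> small (and likewise for \<open>\<psi>\<^sup>-\<^sup>n\<close>), and solving for the highest derivative of the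
  iterate bounds the derivatives inductively.
\<close>

section \<open>Iterated derivatives\<close>

text \<open>The limit conditions quantify over all Schwartz functions, a form that is awkward to
  carry through products and the chain rule. It is exchanged for one pair of constants: if every
  bound \<open>C * (1 + |x|) ^ N\<close> fails, a rapidly decreasing weight can be concentrated on
  the escaping points of failure. Such a weight is far from smooth, so arbitrary
  \<open>rapid\<close> weights replace Schwartz functions throughout, and a Schwartz majorant shows
  that both kinds of weight test the same thing. In the other direction a polynomial bound alone
  makes the weighted expression bounded; a spare factor \<open>1 + |x|\<close>, large on escaping
  sets, makes it tend to 0.

  The obstacle is that nothing places the inverse of \<open>\<psi>\<close> in \<open>O_M\<close>, so
  there is no composition operator for it. The inverse is therefore only composed with compactly
  supported functions, or has its derivatives evaluated on a compact interval. What remains is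
  symmetric in \<open>\<psi>\<close> and its inverse: the second limit condition is the first one
  for the inverse, based at \<open>\<psi> b\<close>.\<close>

definition diff_upto :: "nat \<Rightarrow> (real \<Rightarrow> 'a::real_normed_vector) \<Rightarrow> bool" where
  "diff_upto m f \<longleftrightarrow> (\<forall>j<m. \<forall>x. nderiv j f differentiable at x)"

definition smooth :: "(real \<Rightarrow> 'a::real_normed_vector) \<Rightarrow> bool" where
  "smooth f \<longleftrightarrow> (\<forall>j x. nderiv j f differentiable at x)"

lemma smooth_iff_diff_upto: "smooth f \<longleftrightarrow> (\<forall>m. diff_upto m f)"
  by (auto simp: smooth_def diff_upto_def)

lemma nderiv_shift: "nderiv k (nderiv l f) = nderiv (k + l) f"
  by (induction k) auto

lemma nderiv_Suc_right: "nderiv (Suc k) f = nderiv k (nderiv 1 f)"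
  by (simp only: nderiv_shift) simp

lemma diff_upto_0 [simp]: "diff_upto 0 f"
  by (simp add: diff_upto_def)

lemma diff_upto_mono: "diff_upto m f \<Longrightarrow> l \<le> m \<Longrightarrow> diff_upto l f"
  by (auto simp: diff_upto_def)

lemma diff_upto_Suc:
  "diff_upto (Suc m) f \<longleftrightarrow> (\<forall>x. f differentiable at x) \<and> diff_upto m (nderiv 1 f)"
  unfolding diff_upto_def All_less_Suc2 nderiv_Suc_right[symmetric] by simp

lemma nderiv_1_eqI:
  assumes "\<And>x. (f has_vector_derivative f' x) (at x)"
  shows "nderiv 1 f = f'"
  using assms by (auto simp: vector_derivative_at)

text \<open>The derivative of a product, composition or reciprocal contains functions of the same
  kind, so smoothness is proved order by order. This rule lets an induction on the order treat the
  derivative with one order less.\<close>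

lemma diff_upto_SucI:
  assumes "\<And>x. (f has_vector_derivative f' x) (at x)" and "diff_upto m f'"
  shows "diff_upto (Suc m) f"
proof -
  have "f differentiable at x" for x
    using assms(1) differentiableI_vector by blast
  then show ?thesis
    unfolding diff_upto_Suc nderiv_1_eqI[OF assms(1)] using assms(2) by blast
qed

lemma diff_upto_SucD:
  assumes "diff_upto (Suc m) f"
  shows "(f has_vector_derivative nderiv 1 f x) (at x)" and "diff_upto m (nderiv 1 f)"
    and "diff_upto m f"
  using assms diff_upto_mono[OF assms, of m]
  by (auto simp: diff_upto_Suc vector_derivative_works)

lemma smooth_has_vector_derivative:
  assumes "smooth f"
  shows "(nderiv k f has_vector_derivative nderiv (Suc k) f x) (at x)"
  using assms by (auto simp: smooth_def vector_derivative_works)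

lemma smooth_has_vector_derivative0:
  assumes "smooth f"
  shows "(f has_vector_derivative nderiv 1 f x) (at x)"
  using smooth_has_vector_derivative[OF assms, of 0] by simp

lemma smooth_nderiv: "smooth f \<Longrightarrow> smooth (nderiv k f)"
  by (simp add: smooth_def nderiv_shift)

lemma smooth_continuous_nderiv: "smooth f \<Longrightarrow> continuous_on S (nderiv k f)"
  by (meson continuous_on_vector_derivative has_vector_derivative_at_within
      smooth_has_vector_derivative)

lemma smooth_continuous: "smooth f \<Longrightarrow> continuous_on S f"
  using smooth_continuous_nderiv[of f S 0] by simp

lemma smooth_iff_C_diff: "smooth f \<longleftrightarrow> (\<forall>m\<ge>1. f \<in> C_diff m)"
proof
  assume "smooth f"
  then show "\<forall>m\<ge>1. f \<in> C_diff m"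
    using smooth_continuous_nderiv[of f UNIV] by (auto simp: C_diff_def smooth_def)
next
  assume *: "\<forall>m\<ge>1. f \<in> C_diff m"
  show "smooth f"
    unfolding smooth_def
  proof (intro allI)
    fix j x
    show "nderiv j f differentiable at x"
      using *[rule_format, of "Suc j"] by (auto simp: C_diff_def)
  qed
qed

lemma smooth_C_diff: "smooth f \<Longrightarrow> f \<in> C_diff m"
  using smooth_continuous_nderiv[of f UNIV m] by (simp add: C_diff_def smooth_def)

lemma nderiv_cong_open:
  assumes "open S" and "\<And>y. y \<in> S \<Longrightarrow> f y = g y" and "x \<in> S"
  shows "nderiv k f x = nderiv k g x"
  using assms(3)
proof (induction k arbitrary: x)
  case 0
  then show ?case using assms by simp
next
  case (Suc k)
  have "eventually (\<lambda>y. y \<in> UNIV \<longrightarrow> nderiv k f y = nderiv k g y) (nhds x)"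
    using eventually_nhds_in_open[OF assms(1) Suc.prems] Suc.IH
    by (auto elim: eventually_mono)
  then show ?case
    by (simp add: vector_derivative_cong_eq)
qed

lemma differentiable_cong_open:
  assumes "open S" and "\<And>y. y \<in> S \<Longrightarrow> f y = g y" and "x \<in> S"
    and "f differentiable at x"
  shows "g differentiable at x"
  using assms differentiable_def has_derivative_transform_within_open by metis

lemma smooth_local:
  assumes "\<And>x. \<exists>S g. open S \<and> x \<in> S \<and> smooth g \<and> (\<forall>y\<in>S. f y = g y)"
  shows "smooth f"
  unfolding smooth_def
proof (intro allI)
  fix j x
  obtain S g where S: "open S" "x \<in> S" "smooth g" "\<And>y. y \<in> S \<Longrightarrow> f y = g y"
    using assms by meson
  have "nderiv j g y = nderiv j f y" if "y \<in> S" for y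
    using nderiv_cong_open[OF S(1) S(4) that] by simp
  moreover have "nderiv j g differentiable at x"
    using S(3) by (simp add: smooth_def)
  ultimately show "nderiv j f differentiable at x"
    using differentiable_cong_open[OF S(1) _ S(2)] by blast
qed

subsection \<open>Linear operations\<close>

lemma nderiv_const: "nderiv k (\<lambda>x. c) = (\<lambda>x. if k = 0 then c else 0)"
proof (induction k)
  case (Suc k)
  then show ?case by (cases k) auto
qed auto

lemma smooth_const [simp]: "smooth (\<lambda>x. c)"
  by (simp add: smooth_def nderiv_const)

lemma nderiv_affine:
  fixes a b :: real
  shows "nderiv k (\<lambda>x. a * x + b) =
    (\<lambda>x. if k = 0 then a * x + b else if k = 1 then a else 0)"
proof (cases k)
  case (Suc l)
  have "nderiv 1 (\<lambda>x. a * x + b) = (\<lambda>x. a)"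
    by (rule nderiv_1_eqI)
      (auto intro!: derivative_eq_intros simp flip: has_real_derivative_iff_has_vector_derivative)
  then show ?thesis
    unfolding Suc nderiv_Suc_right[of l] by (auto simp: nderiv_const simp del: nderiv.simps(2))
qed simp

lemma smooth_affine [simp]: "smooth (\<lambda>x::real. a * x + b)"
proof -
  have "diff_upto (Suc m) (\<lambda>x::real. a * x + b)" for m
    using smooth_const[of a, unfolded smooth_iff_diff_upto]
    by (intro diff_upto_SucI[where f' = "\<lambda>x. a"])
      (auto intro!: derivative_eq_intros simp flip: has_real_derivative_iff_has_vector_derivative)
  then show ?thesis
    unfolding smooth_iff_diff_upto by (meson diff_upto_mono le_SucI order_refl)
qed

lemma diff_upto_linear:
  assumes "bounded_linear L" and "diff_upto m f"
  shows "diff_upto m (\<lambda>x. L (f x))"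
  using assms(2)
proof (induction m arbitrary: f)
  case (Suc m)
  note f = diff_upto_SucD[OF Suc.prems]
  show ?case
    by (rule diff_upto_SucI[OF bounded_linear.has_vector_derivative[OF assms(1) f(1)]
          Suc.IH[OF f(2)]])
qed simp

lemma smooth_linear:
  assumes "bounded_linear L" and "smooth f"
  shows "smooth (\<lambda>x. L (f x))"
  using assms unfolding smooth_iff_diff_upto by (auto intro: diff_upto_linear)

lemma nderiv_linear:
  assumes "bounded_linear L" and "smooth f"
  shows "nderiv k (\<lambda>x. L (f x)) = (\<lambda>x. L (nderiv k f x))"
proof (induction k)
  case (Suc k)
  then show ?case
    using bounded_linear.has_vector_derivative[OF assms(1)
        smooth_has_vector_derivative[OF assms(2)], THEN vector_derivative_at] by auto
qed simp

lemma diff_upto_add: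
  assumes "diff_upto m f" and "diff_upto m g"
  shows "diff_upto m (\<lambda>x. f x + g x)"
  using assms
proof (induction m arbitrary: f g)
  case (Suc m)
  note f = diff_upto_SucD[OF Suc.prems(1)] and g = diff_upto_SucD[OF Suc.prems(2)]
  show ?case
    by (rule diff_upto_SucI[OF has_vector_derivative_add[OF f(1) g(1)] Suc.IH[OF f(2) g(2)]])
qed simp

lemma smooth_add: "smooth f \<Longrightarrow> smooth g \<Longrightarrow> smooth (\<lambda>x. f x + g x)"
  unfolding smooth_iff_diff_upto by (auto intro: diff_upto_add)

lemma nderiv_add:
  assumes "smooth f" and "smooth g"
  shows "nderiv k (\<lambda>x. f x + g x) = (\<lambda>x. nderiv k f x + nderiv k g x)"
proof (induction k)
  case (Suc k)
  then show ?case
    using has_vector_derivative_add[OF smooth_has_vector_derivative[OF assms(1)]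
        smooth_has_vector_derivative[OF assms(2)], THEN vector_derivative_at] by auto
qed simp

lemma smooth_uminus: "smooth f \<Longrightarrow> smooth (\<lambda>x. - f x)"
  by (rule smooth_linear[OF bounded_linear_minus[OF bounded_linear_ident]])

lemma nderiv_uminus: "smooth f \<Longrightarrow> nderiv k (\<lambda>x. - f x) = (\<lambda>x. - nderiv k f x)"
  by (rule nderiv_linear[OF bounded_linear_minus[OF bounded_linear_ident]])

lemma smooth_diff: "smooth f \<Longrightarrow> smooth g \<Longrightarrow> smooth (\<lambda>x. f x - g x)"
  using smooth_add[OF _ smooth_uminus, of f g] by simp

lemma nderiv_diff:
  "smooth f \<Longrightarrow> smooth g \<Longrightarrow> nderiv k (\<lambda>x. f x - g x) = (\<lambda>x. nderiv k f x - nderiv k g x)"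
  using nderiv_add[OF _ smooth_uminus, of f g] nderiv_uminus[of g] by simp

lemma smooth_sum:
  "(\<And>i. i \<in> I \<Longrightarrow> smooth (f i)) \<Longrightarrow> smooth (\<lambda>x. \<Sum>i\<in>I. f i x)"
  by (induction I rule: infinite_finite_induct) (auto intro: smooth_add)

lemma nderiv_sum:
  "(\<And>i. i \<in> I \<Longrightarrow> smooth (f i)) \<Longrightarrow>
    nderiv k (\<lambda>x. \<Sum>i\<in>I. f i x) = (\<lambda>x. \<Sum>i\<in>I. nderiv k (f i) x)"
  by (induction I rule: infinite_finite_induct)
    (auto simp: nderiv_zero nderiv_add smooth_sum)

lemma nderiv_translate:
  assumes "smooth f"
  shows "nderiv k (\<lambda>x. f (x - c)) = (\<lambda>x. nderiv k f (x - c))"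
proof (induction k)
  case (Suc k)
  have "((\<lambda>x. nderiv k f (x - c)) has_vector_derivative nderiv (Suc k) f (x - c)) (at x)" for x
  proof -
    have "((\<lambda>x. x - c) has_vector_derivative 1) (at x)"
      by (auto intro!: derivative_eq_intros simp flip: has_real_derivative_iff_has_vector_derivative)
    from vector_diff_chain_at[OF this smooth_has_vector_derivative[OF assms]]
    show ?thesis by (simp add: o_def)
  qed
  then show ?case
    using Suc by (auto intro: vector_derivative_at)
qed simp

subsection \<open>Products, compositions and inverses\<close>

lemma diff_upto_scaleR:
  fixes f :: "real \<Rightarrow> real"
  assumes "diff_upto m f" and "diff_upto m g"
  shows "diff_upto m (\<lambda>x. f x *\<^sub>R g x)"
  using assms
proof (induction m arbitrary: f g)
  case (Suc m)
  note f = diff_upto_SucD[OF Suc.prems(1)] and g = diff_upto_SucD[OF Suc.prems(2)]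
  show ?case
  proof (rule diff_upto_SucI)
    show "((\<lambda>x. f x *\<^sub>R g x) has_vector_derivative
        f x *\<^sub>R nderiv 1 g x + nderiv 1 f x *\<^sub>R g x) (at x)" for x
      using f(1) g(1) by (intro has_vector_derivative_scaleR)
        (auto simp: has_real_derivative_iff_has_vector_derivative)
    show "diff_upto m (\<lambda>x. f x *\<^sub>R nderiv 1 g x + nderiv 1 f x *\<^sub>R g x)"
      using f g by (intro diff_upto_add Suc.IH)
  qed
qed simp

lemma smooth_scaleR:
  fixes f :: "real \<Rightarrow> real"
  shows "smooth f \<Longrightarrow> smooth g \<Longrightarrow> smooth (\<lambda>x. f x *\<^sub>R g x)"
  unfolding smooth_iff_diff_upto by (auto intro: diff_upto_scaleR)

lemma smooth_mult:
  fixes f g :: "real \<Rightarrow> real"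
  shows "smooth f \<Longrightarrow> smooth g \<Longrightarrow> smooth (\<lambda>x. f x * g x)"
  using smooth_scaleR[of f g] by simp

lemma nderiv_scaleR:
  fixes f :: "real \<Rightarrow> real"
  assumes "smooth f" and "smooth g"
  shows "nderiv n (\<lambda>x. f x *\<^sub>R g x) =
    (\<lambda>x. \<Sum>i\<le>n. real (n choose i) *\<^sub>R (nderiv (n - i) f x *\<^sub>R nderiv i g x))"
proof (induction n)
  case (Suc n)
  let ?t = "\<lambda>a b x. nderiv a f x *\<^sub>R nderiv b g x"
  have d: "(?t a b has_vector_derivative ?t a (Suc b) x + ?t (Suc a) b x) (at x)" for a b x
    using assms by (intro has_vector_derivative_scaleR smooth_has_vector_derivative)
      (simp_all only: has_real_derivative_iff_has_vector_derivative smooth_has_vector_derivative)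
  have "vector_derivative (\<lambda>x. \<Sum>i\<le>n. real (n choose i) *\<^sub>R ?t (n - i) i x) (at x)
      = (\<Sum>i\<le>n. real (n choose i) *\<^sub>R (?t (n - i) (Suc i) x + ?t (Suc (n - i)) i x))" for x
    by (intro vector_derivative_at has_vector_derivative_sum
        bounded_linear.has_vector_derivative[OF bounded_linear_scaleR_right] d)
  also have "(\<Sum>i\<le>n. real (n choose i) *\<^sub>R (?t (n - i) (Suc i) x + ?t (Suc (n - i)) i x))
      = (\<Sum>i\<le>Suc n. real (Suc n choose i) *\<^sub>R ?t (Suc n - i) i x)" for x
  proof -
    have "(\<Sum>i\<le>Suc n. real (Suc n choose i) *\<^sub>R ?t (Suc n - i) i x)
        = ?t (Suc n) 0 x + (\<Sum>i\<le>n. real (Suc n choose Suc i) *\<^sub>R ?t (n - i) (Suc i) x)"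
      by (subst sum.atMost_Suc_shift) (simp del: nderiv.simps)
    \<comment> \<open>Pascal's rule splits each coefficient. With the index shifted back, the second
      half would end at \<open>n choose Suc n = 0\<close>, so it is again a sum over
      \<open>i \<le> n\<close>.\<close>
    also have "\<dots> = (\<Sum>i\<le>n. real (n choose i) *\<^sub>R ?t (n - i) (Suc i) x)
        + (?t (Suc n) 0 x + (\<Sum>i\<le>n. real (n choose Suc i) *\<^sub>R ?t (n - i) (Suc i) x))"
      by (simp add: scaleR_add_left distrib_right sum.distrib del: nderiv.simps)
    also have "?t (Suc n) 0 x + (\<Sum>i\<le>n. real (n choose Suc i) *\<^sub>R ?t (n - i) (Suc i) x)
        = (\<Sum>i\<le>Suc n. real (n choose i) *\<^sub>R ?t (Suc n - i) i x)"
      by (subst sum.atMost_Suc_shift) (simp del: nderiv.simps)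
    also have "\<dots> = (\<Sum>i\<le>n. real (n choose i) *\<^sub>R ?t (Suc (n - i)) i x)"
      by (simp add: Suc_diff_le del: nderiv.simps)
    finally show ?thesis
      by (simp add: scaleR_add_right sum.distrib del: nderiv.simps)
  qed
  finally show ?case
    using Suc by simp
qed simp

lemma diff_upto_compose:
  fixes g :: "real \<Rightarrow> real"
  assumes "diff_upto m f" and "diff_upto m g"
  shows "diff_upto m (f \<circ> g)"
  using assms
proof (induction m arbitrary: f)
  case (Suc m)
  note f = diff_upto_SucD[OF Suc.prems(1)] and g = diff_upto_SucD[OF Suc.prems(2)]
  show ?case
  proof (rule diff_upto_SucI)
    show "((f \<circ> g) has_vector_derivative nderiv 1 g x *\<^sub>R (nderiv 1 f \<circ> g) x) (at x)" for x
      using vector_diff_chain_at[OF g(1) f(1)] by simp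
    show "diff_upto m (\<lambda>x. nderiv 1 g x *\<^sub>R (nderiv 1 f \<circ> g) x)"
      using f g by (intro diff_upto_scaleR Suc.IH)
  qed
qed simp

lemma smooth_compose:
  fixes g :: "real \<Rightarrow> real"
  shows "smooth f \<Longrightarrow> smooth g \<Longrightarrow> smooth (f \<circ> g)"
  unfolding smooth_iff_diff_upto by (auto intro: diff_upto_compose)

lemma smooth_funpow:
  fixes g :: "real \<Rightarrow> real"
  assumes "smooth g"
  shows "smooth (g ^^ n)"
proof (induction n)
  case 0
  then show ?case using smooth_affine[of 1 0] by (simp add: id_def)
next
  case (Suc n)
  then show ?case using smooth_compose[OF assms] by (simp only: funpow.simps)
qed

lemma nderiv_1_compose:
  fixes g :: "real \<Rightarrow> real"
  assumes "smooth f" and "smooth g"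
  shows "nderiv 1 (f \<circ> g) = (\<lambda>x. nderiv 1 g x *\<^sub>R (nderiv 1 f \<circ> g) x)"
  using vector_diff_chain_at[OF smooth_has_vector_derivative0[OF assms(2)]
      smooth_has_vector_derivative0[OF assms(1)]]
  by (intro nderiv_1_eqI) simp

lemma nderiv_Suc_compose:
  fixes g :: "real \<Rightarrow> real"
  assumes "smooth f" and "smooth g"
  shows "nderiv (Suc n) (f \<circ> g) x = (\<Sum>i\<le>n. real (n choose i) *\<^sub>R
    (nderiv (Suc n - i) g x *\<^sub>R nderiv i (nderiv 1 f \<circ> g) x))"
proof -
  have "nderiv (n - i) (nderiv 1 g) = nderiv (Suc n - i) g" if "i \<le> n" for i
    using that by (simp only: nderiv_shift) (simp add: Suc_diff_le)
  then show ?thesis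
    using assms unfolding nderiv_Suc_right nderiv_1_compose[OF assms]
    by (subst nderiv_scaleR) (auto intro!: smooth_nderiv smooth_compose simp del: nderiv.simps One_nat_def)
qed

text \<open>The derivative is written as a product of \<open>inverse f\<close> with
  \<open>f'\<close>, so that the induction hypothesis for \<open>inverse f\<close> itself applies to
  it.\<close>

lemma diff_upto_inverse:
  fixes f :: "real \<Rightarrow> real"
  assumes "diff_upto m f" and "\<And>x. f x \<noteq> 0"
  shows "diff_upto m (\<lambda>x. inverse (f x))"
  using assms(1)
proof (induction m)
  case (Suc m)
  note f = diff_upto_SucD[OF Suc.prems(1)]
  have I: "diff_upto m (\<lambda>x. inverse (f x))"
    using Suc.IH f by blast
  show ?case
  proof (rule diff_upto_SucI)
    show "((\<lambda>x. inverse (f x)) has_vector_derivative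
        - (inverse (f x) *\<^sub>R (nderiv 1 f x *\<^sub>R inverse (f x)))) (at x)" for x
      using f(1)[of x] assms(2)
      by (auto intro!: derivative_eq_intros
          simp flip: has_real_derivative_iff_has_vector_derivative)
    show "diff_upto m (\<lambda>x. - (inverse (f x) *\<^sub>R (nderiv 1 f x *\<^sub>R inverse (f x))))"
      using f I by (intro diff_upto_linear[OF bounded_linear_minus[OF bounded_linear_ident]]
          diff_upto_scaleR)
  qed
qed simp

lemma smooth_inverse:
  fixes f :: "real \<Rightarrow> real"
  assumes "smooth f" and "\<And>x. f x \<noteq> 0"
  shows "smooth (\<lambda>x. inverse (f x))"
  using assms unfolding smooth_iff_diff_upto by (auto intro: diff_upto_inverse)

text \<open>From \<open>g' = 1 / (f' o g)\<close>: if \<open>g\<close> has \<open>m\<close>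
  derivatives, so has the right-hand side, and \<open>g\<close> gains one more. Continuity of
  \<open>g\<close> gives the first derivative.\<close>

lemma smooth_inverse_function:
  fixes f g :: "real \<Rightarrow> real"
  assumes f: "smooth f" and d: "\<And>x. nderiv 1 f x \<noteq> 0"
    and inv: "\<And>y. f (g y) = y" and cont: "\<And>y. isCont g y"
  shows "smooth g"
proof -
  have g': "(g has_vector_derivative inverse ((nderiv 1 f \<circ> g) y)) (at y)" for y
    unfolding has_real_derivative_iff_has_vector_derivative[symmetric] o_def
    using smooth_has_vector_derivative0[OF f, of "g y"] d inv cont
    by (intro DERIV_inverse_function[where f = f and a = "y - 1" and b = "y + 1"])
      (auto simp only: has_real_derivative_iff_has_vector_derivative)
  have "diff_upto m g" for m
  proof (induction m)
    case (Suc m)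
    have "diff_upto m (nderiv 1 f)"
      using smooth_nderiv[OF f] unfolding smooth_iff_diff_upto by blast
    then show ?case
      using d Suc by (intro diff_upto_SucI[OF g'] diff_upto_inverse diff_upto_compose) auto
  qed simp
  then show ?thesis
    by (simp add: smooth_iff_diff_upto)
qed

section \<open>Polynomial growth along a filter\<close>

text \<open>The filter on pairs (index, point) says where the bound must hold, with constants common
  to all indices. It is \<open>top\<close> for a single function on the line, \<open>tail A\<close>
  for a sequence on escaping sets, and a principal filter for a family of test functions.\<close>

definition poly_bounded :: "('i \<times> real) filter \<Rightarrow> ('i \<Rightarrow> real \<Rightarrow> 'a::real_normed_vector) \<Rightarrow> bool" where
  "poly_bounded G q \<longleftrightarrow> (\<exists>C N. \<forall>\<^sub>F (i, x) in G. norm (q i x) \<le> C * (1 + \<bar>x\<bar>) ^ N)"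

lemma poly_boundedE:
  assumes "poly_bounded G q"
  obtains C N where "C \<ge> 0" and "\<forall>\<^sub>F (i, x) in G. norm (q i x) \<le> C * (1 + \<bar>x\<bar>) ^ N"
proof -
  obtain C N where *: "\<forall>\<^sub>F (i, x) in G. norm (q i x) \<le> C * (1 + \<bar>x\<bar>) ^ N"
    using assms by (auto simp: poly_bounded_def)
  have le: "C * (1 + \<bar>x\<bar>) ^ N \<le> \<bar>C\<bar> * (1 + \<bar>x\<bar>) ^ N" for x :: real
    by (intro mult_right_mono) auto
  have "\<forall>\<^sub>F (i, x) in G. norm (q i x) \<le> \<bar>C\<bar> * (1 + \<bar>x\<bar>) ^ N"
    using * by eventually_elim (use le in \<open>auto intro: order_trans\<close>)
  then show ?thesis
    using that[of "\<bar>C\<bar>" N] by simp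
qed

lemma poly_boundedI:
  assumes "\<forall>\<^sub>F (i, x) in G. norm (q i x) \<le> C * (1 + \<bar>x\<bar>) ^ N"
  shows "poly_bounded G q"
  using assms unfolding poly_bounded_def by blast

lemma poly_bounded_bounded:
  assumes "\<forall>\<^sub>F (i, x) in G. norm (q i x) \<le> C"
  shows "poly_bounded G q"
  by (rule poly_boundedI[where C = C and N = 0]) (use assms in simp)

lemma poly_bounded_mono:
  assumes "poly_bounded G q" and "\<forall>\<^sub>F (i, x) in G. norm (r i x) \<le> norm (q i x)"
  shows "poly_bounded G r"
proof -
  obtain C N where *: "\<forall>\<^sub>F (i, x) in G. norm (q i x) \<le> C * (1 + \<bar>x\<bar>) ^ N"
    using assms by (auto simp: poly_bounded_def)
  have "\<forall>\<^sub>F (i, x) in G. norm (r i x) \<le> C * (1 + \<bar>x\<bar>) ^ N"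
    using * assms(2) by eventually_elim auto
  then show ?thesis
    by (rule poly_boundedI)
qed

lemma poly_bounded_add:
  assumes "poly_bounded G q" and "poly_bounded G r"
  shows "poly_bounded G (\<lambda>i x. q i x + r i x)"
proof -
  obtain C N where q: "C \<ge> 0" "\<forall>\<^sub>F (i, x) in G. norm (q i x) \<le> C * (1 + \<bar>x\<bar>) ^ N"
    using poly_boundedE[OF assms(1)] .
  obtain D M where r: "D \<ge> 0" "\<forall>\<^sub>F (i, x) in G. norm (r i x) \<le> D * (1 + \<bar>x\<bar>) ^ M"
    using poly_boundedE[OF assms(2)] .
  have le: "norm (q i x + r i x) \<le> (C + D) * (1 + \<bar>x\<bar>) ^ (N + M)"
    if "norm (q i x) \<le> C * (1 + \<bar>x\<bar>) ^ N" "norm (r i x) \<le> D * (1 + \<bar>x\<bar>) ^ M" for i x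
  proof -
    have "C * (1 + \<bar>x\<bar>) ^ N \<le> C * (1 + \<bar>x\<bar>) ^ (N + M)" "D * (1 + \<bar>x\<bar>) ^ M \<le> D * (1 + \<bar>x\<bar>) ^ (N + M)"
      using q(1) r(1) by (auto intro!: mult_left_mono power_increasing)
    then show ?thesis
      using that norm_triangle_ineq[of "q i x" "r i x"] by (simp add: distrib_right)
  qed
  have "\<forall>\<^sub>F (i, x) in G. norm (q i x + r i x) \<le> (C + D) * (1 + \<bar>x\<bar>) ^ (N + M)"
    using q(2) r(2) by eventually_elim (use le in auto)
  then show ?thesis
    by (rule poly_boundedI)
qed

lemma poly_bounded_scaleR:
  assumes "poly_bounded G q" and "poly_bounded G r"
  shows "poly_bounded G (\<lambda>i x. q i x *\<^sub>R r i x)"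
proof -
  obtain C N where q: "C \<ge> 0" "\<forall>\<^sub>F (i, x) in G. norm (q i x) \<le> C * (1 + \<bar>x\<bar>) ^ N"
    using poly_boundedE[OF assms(1)] .
  obtain D M where r: "D \<ge> 0" "\<forall>\<^sub>F (i, x) in G. norm (r i x) \<le> D * (1 + \<bar>x\<bar>) ^ M"
    using poly_boundedE[OF assms(2)] .
  have le: "norm (q i x *\<^sub>R r i x) \<le> (C * D) * (1 + \<bar>x\<bar>) ^ (N + M)"
    if "norm (q i x) \<le> C * (1 + \<bar>x\<bar>) ^ N" "norm (r i x) \<le> D * (1 + \<bar>x\<bar>) ^ M" for i x
    using mult_mono[OF that] q(1) by (simp add: power_add mult_ac)
  have "\<forall>\<^sub>F (i, x) in G. norm (q i x *\<^sub>R r i x) \<le> (C * D) * (1 + \<bar>x\<bar>) ^ (N + M)"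
    using q(2) r(2) by eventually_elim (use le in auto)
  then show ?thesis
    by (rule poly_boundedI)
qed

lemma poly_bounded_const: "poly_bounded G (\<lambda>i x. c)"
  by (rule poly_bounded_bounded[where C = "norm c"]) (simp add: case_prod_unfold)

lemma poly_bounded_sum:
  "(\<And>j. j \<in> J \<Longrightarrow> poly_bounded G (q j)) \<Longrightarrow> poly_bounded G (\<lambda>i x. \<Sum>j\<in>J. q j i x)"
  by (induction J rule: infinite_finite_induct)
    (auto intro: poly_bounded_add poly_bounded_const)

lemma poly_bounded_norm: "poly_bounded G q \<Longrightarrow> poly_bounded G (\<lambda>i x. norm (q i x))"
  by (simp add: poly_bounded_def)

lemma poly_bounded_filter_mono:
  assumes "poly_bounded G q" and "G' \<le> G"
  shows "poly_bounded G' q"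
  using assms filter_leD by (fastforce simp: poly_bounded_def)

lemma poly_bounded_scaleR_derivs:
  fixes f :: "'i \<Rightarrow> real \<Rightarrow> real"
  assumes "\<And>i. smooth (f i)" and "\<And>i. smooth (g i)"
    and "\<And>j. j \<le> k \<Longrightarrow> poly_bounded G (\<lambda>i. nderiv j (f i))"
    and "\<And>j. j \<le> k \<Longrightarrow> poly_bounded G (\<lambda>i. nderiv j (g i))"
  shows "poly_bounded G (\<lambda>i. nderiv k (\<lambda>x. f i x *\<^sub>R g i x))"
  unfolding nderiv_scaleR[OF assms(1,2)]
  by (intro poly_bounded_sum poly_bounded_scaleR poly_bounded_const assms(3,4)) auto

text \<open>This replaces Faa di Bruno's formula: differentiating \<open>(F' \<circ> \<phi>) \<cdot> \<phi>'\<close> with the Leibniz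
  rule reduces the order by one.\<close>

lemma poly_bounded_compose_derivs:
  fixes \<phi> :: "'i \<Rightarrow> real \<Rightarrow> real"
  assumes "\<And>i. smooth (F i)" and "\<And>i. smooth (\<phi> i)"
    and "\<And>l. l \<le> k \<Longrightarrow> poly_bounded G (\<lambda>i x. nderiv l (F i) (\<phi> i x))"
    and "\<And>l. 1 \<le> l \<Longrightarrow> l \<le> k \<Longrightarrow> poly_bounded G (\<lambda>i. nderiv l (\<phi> i))"
  shows "poly_bounded G (\<lambda>i. nderiv k (F i \<circ> \<phi> i))"
  using assms(1,3,4)
proof (induction k arbitrary: F rule: less_induct)
  case (less k)
  show ?case
  proof (cases k)
    case 0
    then show ?thesis
      using less.prems(2)[of 0] by (simp add: o_def)
  next
    case (Suc n)
    have "poly_bounded G (\<lambda>i. nderiv l (nderiv 1 (F i) \<circ> \<phi> i))" if "l \<le> n" for l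
    proof (rule less.IH)
      show "smooth (nderiv 1 (F i))" for i
        using less.prems(1) by (rule smooth_nderiv)
      fix j assume "j \<le> l"
      then show "poly_bounded G (\<lambda>i x. nderiv j (nderiv 1 (F i)) (\<phi> i x))"
        unfolding nderiv_Suc_right[symmetric] using that Suc by (intro less.prems(2)) auto
    qed (use that Suc less.prems(3) in auto)
    then show ?thesis
      unfolding Suc nderiv_Suc_compose[OF less.prems(1) assms(2)]
      using Suc by (intro poly_bounded_sum poly_bounded_scaleR poly_bounded_const less.prems(3)) auto
  qed
qed

section \<open>Slowly increasing functions\<close>

lemma poly_bounded_top:
  "poly_bounded top (\<lambda>_. q) \<longleftrightarrow> (\<exists>C N. \<forall>x. norm (q x) \<le> C * (1 + \<bar>x\<bar>) ^ N)"
  by (simp add: poly_bounded_def)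

lemma one_plus_abs_le: "1 + \<bar>x\<bar> \<le> 2 * (1 + \<bar>x\<bar>\<^sup>2)" for x :: real
proof -
  have "0 \<le> (\<bar>x\<bar> - 1)\<^sup>2" by simp
  also have "\<dots> = \<bar>x\<bar>\<^sup>2 - 2 * \<bar>x\<bar> + 1"
    by (simp add: power2_eq_square algebra_simps)
  finally show ?thesis
    by (smt (verit) zero_le_power2)
qed

text \<open>For a given \<open>m\<close> only the finitely many orders \<open>j \<le> m\<close>
  matter, so one exponent per \<open>m\<close> amounts to a separate exponent for each derivative.
  The two kinds of weight dominate each other up to constants and powers.\<close>

lemma O_M_iff:
  "f \<in> O_M \<longleftrightarrow> smooth f \<and> (\<forall>k. \<exists>C N. \<forall>x. norm (nderiv k f x) \<le> C * (1 + \<bar>x\<bar>) ^ N)"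
proof (intro iffI conjI allI)
  assume f: "f \<in> O_M"
  then have *: "\<exists>n\<ge>1. f \<in> O_mn m n" if "m \<ge> 1" for m
    using that unfolding O_M_def by fastforce
  then show "smooth f"
    unfolding smooth_iff_C_diff by (auto simp: O_mn_def)
  fix k
  \<comment> \<open>Order \<open>Suc k\<close> instead of \<open>k\<close>, because the intersection
    starts at \<open>m = 1\<close>.\<close>
  obtain n where "f \<in> O_mn (Suc k) n"
    using *[of "Suc k"] by auto
  then obtain B where B: "(1 + \<bar>x\<bar>\<^sup>2) powi (- int n) * norm (nderiv j f x) \<le> B" if "j \<le> Suc k" for x j
    unfolding O_mn_def bdd_above_def by fastforce
  have "norm (nderiv k f x) \<le> \<bar>B\<bar> * (1 + \<bar>x\<bar>) ^ (2 * n)" for x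
  proof -
    have pos: "(1 + \<bar>x\<bar>\<^sup>2) ^ n > 0"
      by (smt (verit) zero_le_power2 zero_less_power)
    have "norm (nderiv k f x) \<le> B * (1 + \<bar>x\<bar>\<^sup>2) ^ n"
      using B[of k x] pos by (simp add: power_int_minus field_simps)
    also have "\<dots> \<le> \<bar>B\<bar> * (1 + \<bar>x\<bar>) ^ (2 * n)"
      unfolding power_mult
      by (intro mult_mono power_mono) (auto simp: power2_eq_square algebra_simps)
    finally show ?thesis .
  qed
  then show "\<exists>C N. \<forall>x. norm (nderiv k f x) \<le> C * (1 + \<bar>x\<bar>) ^ N"
    by blast
next
  assume "smooth f \<and> (\<forall>k. \<exists>C N. \<forall>x. norm (nderiv k f x) \<le> C * (1 + \<bar>x\<bar>) ^ N)"
  then obtain C N where sm: "smooth f"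
    and CN: "\<And>k x. norm (nderiv k f x) \<le> C k * (1 + \<bar>x\<bar>) ^ N k"
    by metis
  show "f \<in> O_M"
    unfolding O_M_def
  proof (intro INT_I)
    fix m :: nat assume "m \<in> {1..}"
    \<comment> \<open>The sum dominates each single exponent, and \<open>Suc\<close> makes
      \<open>n\<close> admissible in the union over \<open>n \<ge> 1\<close>.\<close>
    define n where "n = Suc (\<Sum>j\<le>m. N j)"
    have "(1 + \<bar>x\<bar>\<^sup>2) powi (- int n) * norm (nderiv j f x) \<le> (\<Sum>j\<le>m. \<bar>C j\<bar>) * 2 ^ n"
      if "j \<le> m" for x j
    proof -
      have pos: "(1 + \<bar>x\<bar>\<^sup>2) ^ n > 0"
        by (smt (verit) zero_le_power2 zero_less_power)
      have "N j \<le> n"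
        unfolding n_def using member_le_sum[of j "{..m}" N] that by auto
      have "norm (nderiv j f x) \<le> \<bar>C j\<bar> * (1 + \<bar>x\<bar>) ^ n"
        using CN[of j x] \<open>N j \<le> n\<close>
        by (smt (verit) abs_ge_zero mult_mono power_increasing zero_le_power)
      also have "\<dots> \<le> (\<Sum>j\<le>m. \<bar>C j\<bar>) * (2 * (1 + \<bar>x\<bar>\<^sup>2)) ^ n"
        using that one_plus_abs_le[of x]
        by (intro mult_mono power_mono member_le_sum) (auto intro: sum_nonneg)
      finally have "norm (nderiv j f x) \<le> ((\<Sum>j\<le>m. \<bar>C j\<bar>) * 2 ^ n) * (1 + \<bar>x\<bar>\<^sup>2) ^ n"
        unfolding power_mult_distrib by (simp only: mult.assoc)
      then show ?thesis
        using pos by (simp add: power_int_minus pos_divide_le_eq divide_inverse_commute[symmetric]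
            del: power_abs)
    qed
    then have "f \<in> O_mn m n"
      using sm \<open>m \<in> {1..}\<close> unfolding smooth_iff_C_diff O_mn_def by (auto intro!: bdd_aboveI)
    then show "f \<in> (\<Union>n\<in>{1..}. O_mn m n)"
      by (auto simp: n_def)
  qed
qed

lemma O_M_iff_poly_bounded:
  "f \<in> O_M \<longleftrightarrow> smooth f \<and> (\<forall>k. poly_bounded top (\<lambda>_::unit. nderiv k f))"
  unfolding O_M_iff poly_bounded_top ..

lemma O_M_smooth: "f \<in> O_M \<Longrightarrow> smooth f"
  by (simp add: O_M_iff)

lemma poly_bounded_O_M:
  assumes "f \<in> O_M"
  shows "poly_bounded G (\<lambda>_. nderiv k f)"
proof -
  obtain C N where "\<And>x. norm (nderiv k f x) \<le> C * (1 + \<bar>x\<bar>) ^ N"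
    using assms unfolding O_M_iff by meson
  then show ?thesis
    by (intro poly_boundedI[where C = C and N = N] always_eventually) auto
qed

lemma O_M_add: "f \<in> O_M \<Longrightarrow> g \<in> O_M \<Longrightarrow> (\<lambda>x. f x + g x) \<in> O_M"
  by (auto simp: O_M_iff_poly_bounded smooth_add nderiv_add intro: poly_bounded_add)

lemma O_M_linear:
  assumes "bounded_linear L" and "f \<in> O_M"
  shows "(\<lambda>x. L (f x)) \<in> O_M"
proof -
  obtain K where K: "\<And>x. norm (L x) \<le> norm x * K"
    using bounded_linear.bounded[OF assms(1)] by blast
  have "poly_bounded G (\<lambda>_. nderiv k (\<lambda>x. L (f x)))"
    if "poly_bounded G (\<lambda>_. nderiv k f)" for k and G :: "(unit \<times> real) filter"
  proof (rule poly_bounded_mono)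
    show "poly_bounded G (\<lambda>_ x. K *\<^sub>R nderiv k f x)"
      by (intro poly_bounded_scaleR poly_bounded_const that)
    show "\<forall>\<^sub>F (i, x) in G. norm (nderiv k (\<lambda>x. L (f x)) x) \<le> norm (K *\<^sub>R nderiv k f x)"
    proof (rule always_eventually, safe)
      fix x
      have "norm (L (nderiv k f x)) \<le> norm (nderiv k f x) * \<bar>K\<bar>"
        by (rule order_trans[OF K mult_left_mono]) auto
      then show "norm (nderiv k (\<lambda>x. L (f x)) x) \<le> norm (K *\<^sub>R nderiv k f x)"
        using O_M_smooth[OF assms(2)] by (simp add: nderiv_linear[OF assms(1)] mult.commute)
    qed
  qed
  then show ?thesis
    using assms smooth_linear by (auto simp: O_M_iff_poly_bounded)
qed

lemma O_M_diff: "f \<in> O_M \<Longrightarrow> g \<in> O_M \<Longrightarrow> (\<lambda>x. f x - g x) \<in> O_M"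
  using O_M_add[OF _ O_M_linear[OF bounded_linear_minus[OF bounded_linear_ident]], of f g] by simp

lemma O_M_const: "(\<lambda>x. c) \<in> O_M"
  by (auto simp: O_M_iff_poly_bounded nderiv_const intro: poly_bounded_const)

lemma O_M_ident: "(\<lambda>x::real. x) \<in> O_M"
  unfolding O_M_iff
proof (intro conjI allI)
  show "smooth (\<lambda>x::real. x)"
    using smooth_affine[of 1 0] by simp
  fix k
  have "\<forall>x. norm (nderiv k (\<lambda>x::real. x) x) \<le> 1 * (1 + \<bar>x\<bar>) ^ 1"
    using nderiv_affine[of k 1 0] by auto
  then show "\<exists>C N. \<forall>x. norm (nderiv k (\<lambda>x::real. x) x) \<le> C * (1 + \<bar>x\<bar>) ^ N"
    by blast
qed

lemma O_M_of_real: "f \<in> O_M \<Longrightarrow> (\<lambda>x. complex_of_real (f x)) \<in> O_M"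
  by (rule O_M_linear[OF bounded_linear_of_real])

lemma poly_bounded_compose_O_M:
  assumes "f \<in> O_M" and "poly_bounded G \<phi>"
  shows "poly_bounded G (\<lambda>i x. nderiv k f (\<phi> i x))"
proof -
  obtain C N where C: "\<And>x. norm (nderiv k f x) \<le> C * (1 + \<bar>x\<bar>) ^ N"
    using assms(1) unfolding O_M_iff by meson
  obtain D M where D: "D \<ge> 0" "\<forall>\<^sub>F (i, x) in G. norm (\<phi> i x) \<le> D * (1 + \<bar>x\<bar>) ^ M"
    using poly_boundedE[OF assms(2)] .
  have le: "norm (nderiv k f (\<phi> i x)) \<le> (\<bar>C\<bar> * (1 + D) ^ N) * (1 + \<bar>x\<bar>) ^ (M * N)"
    if "norm (\<phi> i x) \<le> D * (1 + \<bar>x\<bar>) ^ M" for i x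
  proof -
    have "1 \<le> (1 + \<bar>x\<bar>) ^ M"
      by simp
    then have *: "1 + \<bar>\<phi> i x\<bar> \<le> (1 + D) * (1 + \<bar>x\<bar>) ^ M"
      unfolding distrib_right mult_1 using that unfolding real_norm_def by linarith
    have "norm (nderiv k f (\<phi> i x)) \<le> C * (1 + \<bar>\<phi> i x\<bar>) ^ N"
      by (rule C)
    also have "\<dots> \<le> \<bar>C\<bar> * ((1 + D) * (1 + \<bar>x\<bar>) ^ M) ^ N"
      using * by (intro mult_mono power_mono) auto
    finally show ?thesis
      by (simp add: power_mult_distrib power_mult mult_ac)
  qed
  have "\<forall>\<^sub>F (i, x) in G. norm (nderiv k f (\<phi> i x)) \<le> (\<bar>C\<bar> * (1 + D) ^ N) * (1 + \<bar>x\<bar>) ^ (M * N)"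
    using D(2) by eventually_elim (use le in auto)
  then show ?thesis
    by (rule poly_boundedI)
qed

lemma O_M_compose:
  fixes \<phi> :: "real \<Rightarrow> real"
  assumes "f \<in> O_M" and "\<phi> \<in> O_M"
  shows "f \<circ> \<phi> \<in> O_M"
proof -
  have \<phi>: "smooth \<phi>" "\<And>l. poly_bounded top (\<lambda>_::unit. nderiv l \<phi>)"
    using assms(2) by (auto simp: O_M_iff_poly_bounded)
  have "poly_bounded top (\<lambda>_::unit. nderiv k (f \<circ> \<phi>))" for k
    using assms \<phi>(2)[of 0] O_M_smooth
    by (intro poly_bounded_compose_derivs poly_bounded_compose_O_M \<phi>) auto
  then show ?thesis
    using assms O_M_smooth smooth_compose by (auto simp: O_M_iff_poly_bounded)
qed

lemma nderiv_eq_0_outside: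
  assumes "\<And>y. \<bar>y\<bar> > R \<Longrightarrow> f y = 0" and "\<bar>x\<bar> > R"
  shows "nderiv k f x = 0"
proof -
  have "open {y::real. \<bar>y\<bar> > R}"
    by (intro open_Collect_less continuous_intros)
  from nderiv_cong_open[OF this, of f "\<lambda>_. 0" x k] show ?thesis
    using assms by (simp add: nderiv_zero)
qed

text \<open>By compactness the derivatives are bounded there, whatever the growth of
  \<open>f\<close> at infinity. This is how the inverse of \<open>\<psi>\<close> can enter
  chain-rule estimates.\<close>

lemma poly_bounded_deriv_on_interval:
  assumes "smooth f" and "\<forall>\<^sub>F (n, x) in G. \<phi> n x \<in> {c..d::real}"
  shows "poly_bounded G (\<lambda>n x. nderiv l f (\<phi> n x))"
proof -
  have "compact (nderiv l f ` {c..d})"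
    by (intro compact_continuous_image smooth_continuous_nderiv assms compact_Icc)
  then obtain C where C: "\<And>x. x \<in> {c..d} \<Longrightarrow> norm (nderiv l f x) \<le> C"
    by (meson bounded_iff compact_imp_bounded imageI)
  have "\<forall>\<^sub>F (n, x) in G. norm (nderiv l f (\<phi> n x)) \<le> C"
    using assms(2) by eventually_elim (use C in auto)
  then show ?thesis
    by (rule poly_bounded_bounded)
qed

lemma compact_support_bounded_deriv:
  assumes "smooth f" and "\<And>y. \<bar>y\<bar> > R \<Longrightarrow> f y = 0"
  shows "\<exists>C\<ge>0. \<forall>x. norm (nderiv k f x) \<le> C"
proof -
  have "compact (nderiv k f ` {- \<bar>R\<bar>..\<bar>R\<bar>})"
    by (intro compact_continuous_image smooth_continuous_nderiv assms compact_Icc)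
  then obtain C where C: "\<And>x. x \<in> {- \<bar>R\<bar>..\<bar>R\<bar>} \<Longrightarrow> norm (nderiv k f x) \<le> C"
    by (meson bounded_iff compact_imp_bounded imageI)
  have "norm (nderiv k f x) \<le> \<bar>C\<bar>" for x
  proof (cases "x \<in> {- \<bar>R\<bar>..\<bar>R\<bar>}")
    case True
    then show ?thesis using C[of x] by simp
  next
    case False
    then have "nderiv k f x = 0"
      by (intro nderiv_eq_0_outside[where R = R] assms(2)) auto
    then show ?thesis by simp
  qed
  then show ?thesis
    using abs_ge_zero by blast
qed

lemma compact_support_O_M:
  assumes "smooth f" and "\<And>y. \<bar>y\<bar> > R \<Longrightarrow> f y = 0"
  shows "f \<in> O_M"
  unfolding O_M_iff
proof (intro conjI allI assms(1))
  fix k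
  obtain C where "\<forall>x. norm (nderiv k f x) \<le> C"
    using compact_support_bounded_deriv[OF assms] by blast
  then show "\<exists>C N. \<forall>x. norm (nderiv k f x) \<le> C * (1 + \<bar>x\<bar>) ^ N"
    by (intro exI[of _ C] exI[of _ 0]) simp
qed

section \<open>A smooth cutoff function\<close>

lemma power_le_fact_exp:
  assumes "t > (0::real)"
  shows "t ^ n \<le> fact n * exp t"
proof -
  have "(\<Sum>k\<in>{n}. t ^ k /\<^sub>R fact k) \<le> (\<Sum>k. t ^ k /\<^sub>R fact k)"
    using assms by (intro sum_le_suminf summable_exp_generic) auto
  then show ?thesis
    by (simp add: exp_def field_simps)
qed

text \<open>The classical flat function \<open>exp (- 1 / x)\<close>, times powers of
  \<open>1 / x\<close>. The family is closed under differentiation up to linear combinations, so one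
  induction yields smoothness of all members.\<close>

definition flat :: "nat \<Rightarrow> real \<Rightarrow> real" where
  "flat n x = (if x > 0 then inverse x ^ n * exp (- inverse x) else 0)"

lemma flat_has_derivative:
  "(flat n has_vector_derivative flat (n + 2) x - real n * flat (n + 1) x) (at x)"
proof -
  consider "x > 0" | "x < 0" | "x = 0" by linarith
  then show ?thesis
  proof cases
    case 1
    let ?f = "\<lambda>x. inverse x ^ n * exp (- inverse x)"
    have "(?f has_real_derivative flat (n + 2) x - real n * flat (n + 1) x) (at x)"
    proof (cases n)
      case 0
      then show ?thesis
        using 1 by (auto intro!: derivative_eq_intros simp: flat_def power2_eq_square)
    next
      case (Suc l)
      show ?thesis
        unfolding Suc using 1
        by (auto intro!: derivative_eq_intros simp: flat_def power2_eq_square algebra_simps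
            simp del: power_Suc) (simp add: algebra_simps)
    qed
    then show ?thesis
      unfolding has_real_derivative_iff_has_vector_derivative
      by (rule has_vector_derivative_transform_within_open[where S = "{0<..}"])
        (use 1 in \<open>auto simp: flat_def\<close>)
  next
    case 2
    have "((\<lambda>x. 0) has_vector_derivative (0::real)) (at x)"
      by simp
    then have "(flat n has_vector_derivative 0) (at x)"
      by (rule has_vector_derivative_transform_within_open[where S = "{..<0}"])
        (use 2 in \<open>auto simp: flat_def\<close>)
    then show ?thesis
      using 2 by (simp add: flat_def)
  next
    case 3
    \<comment> \<open>The exponential beats the power \<open>n + 2\<close> of \<open>1 / h\<close>,
      one more than the difference quotient contains; this leaves a factor \<open>h\<close>
      over.\<close>
    have le: "\<bar>flat n h / h\<bar> \<le> fact (n + 2) * \<bar>h\<bar>" for h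
    proof (cases "h > 0")
      case True
      have "inverse h ^ (n + 2) * exp (- inverse h) \<le> fact (n + 2)"
        using power_le_fact_exp[of "inverse h" "n + 2"] True
        by (simp add: exp_minus field_simps del: power_add fact_Suc)
      then have "h * (inverse h ^ (n + 2) * exp (- inverse h)) \<le> h * fact (n + 2)"
        using True by (intro mult_left_mono) auto
      then show ?thesis
        using True by (simp add: flat_def field_simps power2_eq_square del: fact_Suc)
    next
      case False
      have "0 \<le> fact (n + 2) * \<bar>h\<bar>"
        by (rule mult_nonneg_nonneg) simp_all
      then show ?thesis
        using False unfolding flat_def by (simp only: if_False div_0 abs_zero)
    qed
    have "((\<lambda>h. flat n h / h) \<longlongrightarrow> 0) (at 0)"
    proof (rule Lim_null_comparison)
      show "\<forall>\<^sub>F h in at 0. norm (flat n h / h) \<le> fact (n + 2) * \<bar>h\<bar>"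
        by (rule always_eventually) (use le in simp)
      show "((\<lambda>h. fact (n + 2) * \<bar>h\<bar>) \<longlongrightarrow> (0::real)) (at 0)"
        by (auto intro!: tendsto_eq_intros simp del: fact_Suc)
    qed
    then have "(flat n has_real_derivative 0) (at 0)"
      by (simp add: has_field_derivative_iff flat_def)
    then show ?thesis
      using 3 by (simp add: flat_def has_real_derivative_iff_has_vector_derivative)
  qed
qed

lemma smooth_flat: "smooth (flat n)"
proof -
  have "diff_upto m (flat n)" for m
  proof (induction m arbitrary: n)
    case (Suc m)
    have "diff_upto m (\<lambda>x. flat (n + 2) x + (- real n) *\<^sub>R flat (n + 1) x)"
      by (intro diff_upto_add diff_upto_linear[OF bounded_linear_scaleR_right] Suc.IH)
    then show ?case
      by (intro diff_upto_SucI[OF flat_has_derivative]) simp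
  qed simp
  then show ?thesis
    by (simp add: smooth_iff_diff_upto)
qed

definition smooth_step :: "real \<Rightarrow> real" where
  "smooth_step x = flat 0 x * inverse (flat 0 x + flat 0 (1 - x))"

definition cutoff :: "real \<Rightarrow> real" where
  "cutoff x = smooth_step (2 - x) * smooth_step (2 + x)"

lemma smooth_smooth_step: "smooth smooth_step"
proof -
  have "smooth (flat 0 \<circ> (\<lambda>x. (-1) * x + 1))"
    by (intro smooth_compose smooth_flat smooth_affine)
  then have "smooth (\<lambda>x. flat 0 (1 - x))"
    by (simp add: o_def)
  moreover have "flat 0 x + flat 0 (1 - x) \<noteq> 0" for x
    by (auto simp: flat_def add_pos_pos less_imp_neq[symmetric])
  ultimately show ?thesis
    unfolding smooth_step_def by (intro smooth_mult smooth_inverse smooth_add smooth_flat) auto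
qed

lemma smooth_cutoff: "smooth cutoff"
proof -
  have "smooth (smooth_step \<circ> (\<lambda>x. (-1) * x + 2))" "smooth (smooth_step \<circ> (\<lambda>x. 1 * x + 2))"
    by (intro smooth_compose smooth_smooth_step smooth_affine)+
  then show ?thesis
    unfolding cutoff_def by (intro smooth_mult) (simp_all add: o_def add.commute)
qed

lemma cutoff_nonneg: "cutoff x \<ge> 0"
  by (simp add: cutoff_def smooth_step_def flat_def)

lemma cutoff_eq_1: "\<bar>x\<bar> \<le> 1 \<Longrightarrow> cutoff x = 1"
  by (auto simp add: cutoff_def smooth_step_def flat_def)

lemma cutoff_eq_0: "\<bar>x\<bar> \<ge> 2 \<Longrightarrow> cutoff x = 0"
  by (auto simp: cutoff_def smooth_step_def flat_def)

section \<open>Rapidly decreasing weights\<close>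

text \<open>What is left of the modulus of a Schwartz function when smoothness is dropped; cut-off
  constants and weights living on isolated points are allowed.\<close>

definition rapid :: "(real \<Rightarrow> real) \<Rightarrow> bool" where
  "rapid u \<longleftrightarrow> (\<forall>x. u x \<ge> 0) \<and> (\<forall>N. \<exists>C. \<forall>x. u x * (1 + \<bar>x\<bar>) ^ N \<le> C)"

lemma rapid_nonneg: "rapid u \<Longrightarrow> u x \<ge> 0"
  by (simp add: rapid_def)

lemma rapidE:
  assumes "rapid u"
  obtains C where "C \<ge> 0" and "\<And>x. u x * (1 + \<bar>x\<bar>) ^ N \<le> C"
proof -
  obtain C where C: "\<And>x. u x * (1 + \<bar>x\<bar>) ^ N \<le> C"
    using assms unfolding rapid_def by meson
  moreover have "0 \<le> C"
    using C[of 0] rapid_nonneg[OF assms, of 0] by simp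
  ultimately show ?thesis
    using that by blast
qed

lemma rapid_bounded_support:
  assumes "\<And>x. 0 \<le> u x" and "\<And>x. u x \<le> c" and "\<And>x. \<bar>x\<bar> > R \<Longrightarrow> u x = 0"
  shows "rapid u"
  unfolding rapid_def
proof (intro conjI allI assms(1))
  fix N
  have "u x * (1 + \<bar>x\<bar>) ^ N \<le> c * (1 + \<bar>R\<bar>) ^ N" for x
  proof (cases "\<bar>x\<bar> > R")
    case True
    have "0 \<le> c"
      using assms(1)[of 0] assms(2)[of 0] by linarith
    then show ?thesis
      using True assms(3) by simp
  next
    case False
    then show ?thesis
      using assms(1)[of x] assms(2)[of x] by (intro mult_mono power_mono) auto
  qed
  then show "\<exists>C. \<forall>x. u x * (1 + \<bar>x\<bar>) ^ N \<le> C"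
    by blast
qed

lemma rapid_indicator: "c \<ge> 0 \<Longrightarrow> rapid (\<lambda>x. if \<bar>x\<bar> \<le> R then c else 0)"
  by (rule rapid_bounded_support[where c = c and R = R]) auto

lemma rapid_add:
  assumes "rapid u" and "rapid w"
  shows "rapid (\<lambda>x. u x + w x)"
  unfolding rapid_def
proof (intro conjI allI)
  show "0 \<le> u x + w x" for x
    using assms by (simp add: rapid_nonneg)
  fix N
  obtain C where "0 \<le> C" and C: "\<And>x. u x * (1 + \<bar>x\<bar>) ^ N \<le> C"
    using rapidE[OF assms(1), of N] by blast
  obtain D where "0 \<le> D" and D: "\<And>x. w x * (1 + \<bar>x\<bar>) ^ N \<le> D"
    using rapidE[OF assms(2), of N] by blast
  have "(u x + w x) * (1 + \<bar>x\<bar>) ^ N \<le> C + D" for x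
    using add_mono[OF C[of x] D[of x]] by (simp add: distrib_right)
  then show "\<exists>C. \<forall>x. (u x + w x) * (1 + \<bar>x\<bar>) ^ N \<le> C"
    by blast
qed

lemma rapid_mult_poly:
  assumes "rapid u" and "D \<ge> 0"
  shows "rapid (\<lambda>x. u x * (D * (1 + \<bar>x\<bar>) ^ M))"
  unfolding rapid_def
proof (intro conjI allI)
  show "0 \<le> u x * (D * (1 + \<bar>x\<bar>) ^ M)" for x
    using assms by (simp add: rapid_nonneg)
  fix N
  obtain C where "0 \<le> C" and C: "\<And>x. u x * (1 + \<bar>x\<bar>) ^ (M + N) \<le> C"
    using rapidE[OF assms(1), of "M + N"] by blast
  have "u x * (D * (1 + \<bar>x\<bar>) ^ M) * (1 + \<bar>x\<bar>) ^ N \<le> D * C" for x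
    using mult_left_mono[OF C[of x] assms(2)] by (simp add: power_add mult_ac)
  then show "\<exists>C. \<forall>x. u x * (D * (1 + \<bar>x\<bar>) ^ M) * (1 + \<bar>x\<bar>) ^ N \<le> C"
    by blast
qed

lemma rapid_cmult: "rapid u \<Longrightarrow> D \<ge> 0 \<Longrightarrow> rapid (\<lambda>x. D * u x)"
  using rapid_mult_poly[of u D 0] by (simp add: mult.commute)

lemma schwartz_rapid:
  assumes "v \<in> schwartz"
  shows "rapid (\<lambda>x. norm (v x))"
  unfolding rapid_def
proof (intro conjI allI)
  fix N
  have bdd: "bdd_above (range (\<lambda>x. \<bar>x\<bar> ^ k * norm (nderiv 0 v x)))" for k
    using assms unfolding schwartz_def mem_Collect_eq by (elim conjE allE)
  have "\<exists>B. \<forall>x. \<bar>x\<bar> ^ k * norm (v x) \<le> B" for k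
    using bdd[of k] unfolding bdd_above_def by simp
  then obtain B where B: "\<And>k x. \<bar>x\<bar> ^ k * norm (v x) \<le> B k"
    by metis
  have "norm (v x) * (1 + \<bar>x\<bar>) ^ N \<le> (\<Sum>k\<le>N. real (N choose k) * B k)" for x
  proof -
    have "(1 + \<bar>x\<bar>) ^ N = (\<Sum>k\<le>N. real (N choose k) * \<bar>x\<bar> ^ k)"
      using binomial_ring[of "\<bar>x\<bar>" 1 N] by (simp add: add.commute)
    then have "norm (v x) * (1 + \<bar>x\<bar>) ^ N = (\<Sum>k\<le>N. real (N choose k) * (\<bar>x\<bar> ^ k * norm (v x)))"
      by (simp add: sum_distrib_left mult_ac)
    also have "\<dots> \<le> (\<Sum>k\<le>N. real (N choose k) * B k)"
      by (intro sum_mono mult_left_mono B) auto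
    finally show ?thesis .
  qed
  then show "\<exists>C. \<forall>x. norm (v x) * (1 + \<bar>x\<bar>) ^ N \<le> C"
    by blast
qed auto

text \<open>Prepared for the majorant below: an integer \<open>k\<close> in its window is at most 6
  away from \<open>x\<close>, and the supremum attached to \<open>k\<close> looks 1 further, whence
  7. Then \<open>1 + |x| \<le> 8 * (1 + |y|)\<close>.\<close>

lemma rapid_near:
  assumes "rapid u"
  obtains C where "\<And>x y. \<bar>x - y\<bar> \<le> 7 \<Longrightarrow> u y * (1 + \<bar>x\<bar>) ^ N \<le> C"
proof -
  obtain C where C: "C \<ge> 0" "\<And>x. u x * (1 + \<bar>x\<bar>) ^ N \<le> C"
    using rapidE[OF assms, of N] by blast
  have "u y * (1 + \<bar>x\<bar>) ^ N \<le> 8 ^ N * C" if "\<bar>x - y\<bar> \<le> 7" for x y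
  proof -
    have "(1 + \<bar>x\<bar>) ^ N \<le> (8 * (1 + \<bar>y\<bar>)) ^ N"
      using that by (intro power_mono) auto
    then have "u y * (1 + \<bar>x\<bar>) ^ N \<le> u y * (8 * (1 + \<bar>y\<bar>)) ^ N"
      by (intro mult_left_mono rapid_nonneg[OF assms])
    also have "\<dots> = 8 ^ N * (u y * (1 + \<bar>y\<bar>) ^ N)"
      unfolding power_mult_distrib by (simp only: mult_ac)
    also have "\<dots> \<le> 8 ^ N * C"
      by (intro mult_left_mono C) auto
    finally show ?thesis .
  qed
  then show ?thesis
    using that by blast
qed

text \<open>The majorant is \<open>\<Sum>k. U k \<cdot> cutoff (x - k)\<close> over the integers, where \<open>U k\<close> is the
  supremum of the weight on \<open>[k - 1, k + 1]\<close>; near each point only finitely many terms contribute.\<close>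

lemma schwartz_majorant:
  assumes "rapid u"
  obtains v where "v \<in> schwartz" and "\<And>x. u x \<le> norm (v x)"
proof -
  define U where "U k = (SUP y\<in>{of_int k - 1..of_int k + 1::real}. u y)" for k :: int
  obtain B where B: "\<And>x. u x \<le> B"
    using rapidE[OF assms, of 0] by (metis mult.right_neutral power_0)
  have bdd: "bdd_above (u ` S)" for S
    using B by (rule bdd_aboveI2)
  have U_ge: "u y \<le> U k" if "\<bar>y - of_int k\<bar> \<le> 1" for y k
    unfolding U_def using that by (intro cSUP_upper bdd) auto
  have U_le: "U k \<le> c" if "\<And>y. \<bar>y - of_int k\<bar> \<le> 1 \<Longrightarrow> u y \<le> c" for k c
    unfolding U_def using that by (intro cSUP_least) auto
  have U_nonneg: "U k \<ge> 0" for k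
    using U_ge[of "of_int k" k] rapid_nonneg[OF assms, of "of_int k"] by simp
  \<comment> \<open>The window of \<open>v\<close> moves with the floor of \<open>x\<close>, so its
    smoothness is not visible. Near an integer \<open>m\<close> it equals \<open>w m\<close>, whose
    window is fixed: terms more than 3 from the floor vanish, and 5 leaves room for the floor to
    move by 2.\<close>
  define w where "w m x = (\<Sum>k\<in>{m-5..m+5}. U k *\<^sub>R cutoff (x - of_int k))" for m :: int and x
  define v where "v x = (\<Sum>k\<in>{\<lfloor>x\<rfloor>-3..\<lfloor>x\<rfloor>+3}. U k *\<^sub>R cutoff (x - of_int k))" for x
  have local: "v y = w m y" if "\<bar>y - of_int m\<bar> < 2" for y m
    unfolding v_def w_def
  proof (rule sum.mono_neutral_left)
    show "{\<lfloor>y\<rfloor> - 3..\<lfloor>y\<rfloor> + 3} \<subseteq> {m - 5..m + 5}"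
      using that by (auto; linarith)
    show "\<forall>k\<in>{m - 5..m + 5} - {\<lfloor>y\<rfloor> - 3..\<lfloor>y\<rfloor> + 3}. U k *\<^sub>R cutoff (y - of_int k) = 0"
    proof
      fix k assume "k \<in> {m - 5..m + 5} - {\<lfloor>y\<rfloor> - 3..\<lfloor>y\<rfloor> + 3}"
      then have "k < \<lfloor>y\<rfloor> - 3 \<or> k > \<lfloor>y\<rfloor> + 3"
        by auto
      then have "\<bar>y - of_int k\<bar> \<ge> 2"
        by linarith
      then show "U k *\<^sub>R cutoff (y - of_int k) = 0"
        by (simp add: cutoff_eq_0)
    qed
  qed simp
  have smt: "smooth (\<lambda>x. cutoff (x - of_int k))" for k
    using smooth_compose[OF smooth_cutoff smooth_affine[of 1 "- of_int k"]] by (simp add: o_def)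
  have smw: "smooth (w m)" for m
    unfolding w_def by (intro smooth_sum smooth_linear[OF bounded_linear_scaleR_right] smt)
  have opn: "open {y. \<bar>y - of_int m\<bar> < (2::real)}" for m :: int
    by (intro open_Collect_less continuous_intros)
  have flo: "\<bar>x - of_int \<lfloor>x\<rfloor>\<bar> < 2" for x :: real
    by linarith
  have smv: "smooth v"
  proof (rule smooth_local)
    fix x
    show "\<exists>S g. open S \<and> x \<in> S \<and> smooth g \<and> (\<forall>y\<in>S. v y = g y)"
      by (intro exI[of _ "{y. \<bar>y - of_int \<lfloor>x\<rfloor>\<bar> < 2}"] exI[of _ "w \<lfloor>x\<rfloor>"] conjI opn smw)
        (use local flo in auto)
  qed
  have dv: "nderiv l v x = (\<Sum>k\<in>{\<lfloor>x\<rfloor>-5..\<lfloor>x\<rfloor>+5}. U k *\<^sub>R nderiv l cutoff (x - of_int k))" for l x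
  proof -
    have "nderiv l v x = nderiv l (w \<lfloor>x\<rfloor>) x"
      by (rule nderiv_cong_open[OF opn[of "\<lfloor>x\<rfloor>"]]) (use local flo in auto)
    then show ?thesis
      unfolding w_def
      by (simp add: nderiv_sum smooth_linear[OF bounded_linear_scaleR_right] smt
          nderiv_linear[OF bounded_linear_scaleR_right] nderiv_translate smooth_cutoff
          del: real_scaleR_def)
  qed
  have bddv: "bdd_above (range (\<lambda>x. \<bar>x\<bar> ^ N * norm (nderiv l v x)))" for N l
  proof -
    obtain C where C: "\<And>x y. \<bar>x - y\<bar> \<le> 7 \<Longrightarrow> u y * (1 + \<bar>x\<bar>) ^ N \<le> C"
      using rapid_near[OF assms, of N] by blast
    have "\<exists>D\<ge>0. \<forall>x. norm (nderiv l cutoff x) \<le> D"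
      by (rule compact_support_bounded_deriv[OF smooth_cutoff, of 2]) (simp add: cutoff_eq_0)
    then obtain D where D: "D \<ge> 0" "\<And>x. norm (nderiv l cutoff x) \<le> D"
      by blast
    have "\<bar>x\<bar> ^ N * norm (nderiv l v x) \<le> (\<Sum>k\<in>{\<lfloor>x\<rfloor>-5..\<lfloor>x\<rfloor>+5}. C * D)" for x
    proof -
      have pos: "(1 + \<bar>x\<bar>) ^ N > 0"
        by (intro zero_less_power) auto
      have Uk: "U k * (1 + \<bar>x\<bar>) ^ N \<le> C" if "k \<in> {\<lfloor>x\<rfloor>-5..\<lfloor>x\<rfloor>+5}" for k
      proof -
        have "U k \<le> C / (1 + \<bar>x\<bar>) ^ N"
        proof (rule U_le)
          fix y :: real assume "\<bar>y - of_int k\<bar> \<le> 1"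
          moreover have "\<bar>of_int k - x\<bar> \<le> 6"
            using that by (auto; linarith)
          ultimately have "\<bar>x - y\<bar> \<le> 7"
            by linarith
          then show "u y \<le> C / (1 + \<bar>x\<bar>) ^ N"
            using C[of x y] pos by (simp add: pos_le_divide_eq)
        qed
        then show ?thesis
          using pos by (simp add: pos_le_divide_eq)
      qed
      have "\<bar>x\<bar> ^ N * norm (nderiv l v x) \<le> (1 + \<bar>x\<bar>) ^ N * norm (nderiv l v x)"
        by (intro mult_right_mono power_mono) auto
      also have "\<dots> \<le> (1 + \<bar>x\<bar>) ^ N *
          (\<Sum>k\<in>{\<lfloor>x\<rfloor>-5..\<lfloor>x\<rfloor>+5}. U k * norm (nderiv l cutoff (x - of_int k)))"
        unfolding dv using U_nonneg
        by (intro mult_left_mono order_trans[OF norm_sum]) (auto simp: abs_mult intro!: sum_mono)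
      also have "\<dots> = (\<Sum>k\<in>{\<lfloor>x\<rfloor>-5..\<lfloor>x\<rfloor>+5}.
          (U k * (1 + \<bar>x\<bar>) ^ N) * norm (nderiv l cutoff (x - of_int k)))"
        by (simp add: sum_distrib_left mult_ac)
      also have "\<dots> \<le> (\<Sum>k\<in>{\<lfloor>x\<rfloor>-5..\<lfloor>x\<rfloor>+5}. C * D)"
        using U_nonneg pos
        by (intro sum_mono mult_mono Uk D(2)) (auto intro: order_trans[OF _ Uk])
      finally show ?thesis .
    qed
    then have "\<bar>x\<bar> ^ N * norm (nderiv l v x) \<le> 11 * (C * D)" for x
      by simp
    then show ?thesis
      by (auto intro!: bdd_aboveI)
  qed
  have "nderiv l (\<lambda>x. complex_of_real (v x)) = (\<lambda>x. complex_of_real (nderiv l v x))" for l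
    by (rule nderiv_linear[OF bounded_linear_of_real smv])
  with bddv have "bdd_above (range (\<lambda>x. \<bar>x\<bar> ^ N * norm (nderiv l (\<lambda>x. complex_of_real (v x)) x)))" for N l
    by simp
  moreover have "smooth (\<lambda>x. complex_of_real (v x))"
    by (rule smooth_linear[OF bounded_linear_of_real smv])
  ultimately have "(\<lambda>x. complex_of_real (v x)) \<in> schwartz"
    unfolding schwartz_def by (intro CollectI conjI allI smooth_C_diff)
  moreover have "u x \<le> norm (complex_of_real (v x))" for x
  proof -
    have "u x \<le> U \<lfloor>x\<rfloor> *\<^sub>R cutoff (x - of_int \<lfloor>x\<rfloor>)"
      using U_ge[of x "\<lfloor>x\<rfloor>"] by (subst cutoff_eq_1) (auto; linarith)+
    also have "\<dots> \<le> v x"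
      unfolding v_def using U_nonneg cutoff_nonneg by (intro member_le_sum) auto
    finally show ?thesis
      by simp
  qed
  ultimately show ?thesis
    using that by blast
qed

section \<open>Neighbourhoods in the topology of \<open>O_M\<close>\<close>

text \<open>The radius is always 1, since any other radius can be absorbed into the weight.\<close>

definition OM_nhd :: "(real \<Rightarrow> complex) \<Rightarrow> nat \<Rightarrow> (real \<Rightarrow> real) \<Rightarrow> (real \<Rightarrow> complex) set" where
  "OM_nhd f m u = {g \<in> O_M. \<forall>x. \<forall>j\<le>m. u x * norm (nderiv j (\<lambda>x. g x - f x) x) \<le> 1}"

text \<open>A real supremum bounds its members only if they are bounded above; here this comes from
  polynomial growth of the derivatives of \<open>d\<close> against rapid decay of
  \<open>v\<close>.\<close>

lemma OM_seminorm_bounds: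
  assumes "v \<in> schwartz" and "d \<in> O_M"
  shows "j \<le> m \<Longrightarrow> norm (v x * nderiv j d x) \<le> OM_seminorm m v d"
proof -
  let ?M = "\<lambda>x. MAX j\<in>{0..m}. norm (v x * nderiv j d x)"
  have "\<exists>B. \<forall>x. norm (v x * nderiv j d x) \<le> B" for j
  proof -
    obtain C N where C: "\<And>x. norm (nderiv j d x) \<le> C * (1 + \<bar>x\<bar>) ^ N"
      using assms(2) unfolding O_M_iff by meson
    obtain D where D: "0 \<le> D" "\<And>x. norm (v x) * (1 + \<bar>x\<bar>) ^ N \<le> D"
      using rapidE[OF schwartz_rapid[OF assms(1)], of N] by blast
    have "norm (v x * nderiv j d x) \<le> \<bar>C\<bar> * D" for x
    proof -
      have "norm (v x * nderiv j d x) \<le> norm (v x) * (\<bar>C\<bar> * (1 + \<bar>x\<bar>) ^ N)"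
        unfolding norm_mult
        by (intro mult_left_mono order_trans[OF C] mult_right_mono) auto
      also have "\<dots> = \<bar>C\<bar> * (norm (v x) * (1 + \<bar>x\<bar>) ^ N)"
        by (simp only: mult_ac)
      also have "\<dots> \<le> \<bar>C\<bar> * D"
        by (intro mult_left_mono D) auto
      finally show ?thesis .
    qed
    then show ?thesis by blast
  qed
  then obtain B where B: "\<And>j x. norm (v x * nderiv j d x) \<le> B j"
    by metis
  have "?M x \<le> Max (B ` {0..m})" for x
  proof (intro Max.boundedI)
    fix a assume "a \<in> (\<lambda>j. norm (v x * nderiv j d x)) ` {0..m}"
    then obtain j where "j \<in> {0..m}" "a = norm (v x * nderiv j d x)"
      by auto
    then show "a \<le> Max (B ` {0..m})"
      using order_trans[OF B Max_ge] by auto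
  qed auto
  then have bdd: "bdd_above (range ?M)"
    by (rule bdd_aboveI2)
  assume "j \<le> m"
  then have "norm (v x * nderiv j d x) \<le> ?M x"
    by (intro Max_ge) auto
  also have "\<dots> \<le> OM_seminorm m v d"
    unfolding OM_seminorm_def by (rule cSUP_upper[OF _ bdd]) auto
  finally show "norm (v x * nderiv j d x) \<le> OM_seminorm m v d" .
qed

lemma OM_seminorm_le:
  assumes "\<And>x j. j \<le> m \<Longrightarrow> norm (v x * nderiv j d x) \<le> c"
  shows "OM_seminorm m v d \<le> c"
  unfolding OM_seminorm_def using assms by (intro cSUP_least) auto

lemma nderiv_diff_split:
  assumes "f \<in> O_M" and "g \<in> O_M" and "h \<in> O_M"
  shows "nderiv j (\<lambda>x. g x - h x) x = nderiv j (\<lambda>x. g x - f x) x + nderiv j (\<lambda>x. f x - h x) x"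
  using assms[THEN O_M_smooth] by (simp add: nderiv_diff)

lemma OM_nhd_antimono:
  assumes "m \<le> m'" and "\<And>x. u x \<le> u' x"
  shows "OM_nhd f m' u' \<subseteq> OM_nhd f m u"
proof
  fix g assume g: "g \<in> OM_nhd f m' u'"
  have "u x * norm (nderiv j (\<lambda>x. g x - f x) x) \<le> 1" if "j \<le> m" for x j
  proof -
    have "u x * norm (nderiv j (\<lambda>x. g x - f x) x) \<le> u' x * norm (nderiv j (\<lambda>x. g x - f x) x)"
      by (intro mult_right_mono assms) auto
    also have "\<dots> \<le> 1"
      using g that assms(1) by (auto simp: OM_nhd_def)
    finally show ?thesis .
  qed
  then show "g \<in> OM_nhd f m u"
    using g by (auto simp: OM_nhd_def)
qed

text \<open>Induction over the generation of the topology. An intersection takes the larger order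
  and the sum of the weights; a subbasic set with another centre contains a smaller set around
  \<open>f\<close> by the triangle inequality.\<close>

lemma OM_open_contains_nhd:
  assumes "openin OM_topology W" and "f \<in> W"
  shows "\<exists>m u. rapid u \<and> OM_nhd f m u \<subseteq> W"
proof -
  have "generate_topology_on {{g \<in> O_M. OM_seminorm m v (\<lambda>x. g x - f x) < \<epsilon>} | m v f \<epsilon>.
      v \<in> schwartz \<and> f \<in> O_M \<and> \<epsilon> > 0} W"
    using openin_topology_generated_by[OF assms(1)[unfolded OM_topology_def]] .
  then show ?thesis
    using assms(2)
  proof (induction rule: generate_topology_on.induct)
    case (Int a b)
    then obtain m u m' u' where "rapid u" "OM_nhd f m u \<subseteq> a" "rapid u'" "OM_nhd f m' u' \<subseteq> b"
      by blast
    then show ?case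
      using OM_nhd_antimono[of m "max m m'" u "\<lambda>x. u x + u' x" f]
        OM_nhd_antimono[of m' "max m m'" u' "\<lambda>x. u x + u' x" f]
      by (intro exI[of _ "max m m'"] exI[of _ "\<lambda>x. u x + u' x"])
        (auto simp: rapid_add rapid_nonneg)
  next
    case (Basis s)
    then obtain m v h \<epsilon> where s: "s = {g \<in> O_M. OM_seminorm m v (\<lambda>x. g x - h x) < \<epsilon>}"
      and v: "v \<in> schwartz" and h: "h \<in> O_M"
      by blast
    \<comment> \<open>The distance left to the boundary. The factor \<open>2 / \<delta>\<close>
      below spends only half of it, so the inequality stays strict after taking the
      supremum.\<close>
    define \<delta> where "\<delta> = \<epsilon> - OM_seminorm m v (\<lambda>x. f x - h x)"
    have f: "f \<in> O_M" and \<delta>: "\<delta> > 0"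
      using Basis s by (auto simp: \<delta>_def)
    have "OM_nhd f m (\<lambda>x. (2 / \<delta>) * norm (v x)) \<subseteq> s"
    proof
      fix g assume g: "g \<in> OM_nhd f m (\<lambda>x. (2 / \<delta>) * norm (v x))"
      then have gO: "g \<in> O_M"
        by (simp add: OM_nhd_def)
      have "OM_seminorm m v (\<lambda>x. g x - h x) \<le> \<delta> / 2 + OM_seminorm m v (\<lambda>x. f x - h x)"
      proof (rule OM_seminorm_le)
        fix x j assume j: "j \<le> m"
        have "(2 / \<delta>) * norm (v x) * norm (nderiv j (\<lambda>x. g x - f x) x) \<le> 1"
          using g j by (auto simp: OM_nhd_def)
        then have "norm (v x * nderiv j (\<lambda>x. g x - f x) x) \<le> \<delta> / 2"
          using \<delta> by (simp add: norm_mult field_simps)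
        moreover have "norm (v x * nderiv j (\<lambda>x. f x - h x) x) \<le> OM_seminorm m v (\<lambda>x. f x - h x)"
          by (rule OM_seminorm_bounds[OF v O_M_diff[OF f h] j])
        ultimately show "norm (v x * nderiv j (\<lambda>x. g x - h x) x)
            \<le> \<delta> / 2 + OM_seminorm m v (\<lambda>x. f x - h x)"
          unfolding nderiv_diff_split[OF f gO h] distrib_left
          by (rule norm_triangle_mono)
      qed
      also have "\<dots> < \<epsilon>"
        using \<delta> by (simp add: \<delta>_def field_simps)
      finally show "g \<in> s"
        using gO s by simp
    qed
    then show ?case
      using rapid_cmult[OF schwartz_rapid[OF v], of "2 / \<delta>"] \<delta>
      by (intro exI[of _ m] exI[of _ "\<lambda>x. (2 / \<delta>) * norm (v x)"]) auto
  qed blast+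
qed

text \<open>Although \<open>u\<close> may be discontinuous, its Schwartz majorant defines a seminorm
  ball inside the set. Mixing can thus be tested against weights chosen at will.\<close>

lemma OM_nhd_contains_open:
  assumes "f \<in> O_M" and "rapid u"
  shows "\<exists>W. openin OM_topology W \<and> f \<in> W \<and> W \<subseteq> OM_nhd f m u"
proof -
  obtain v where v: "v \<in> schwartz" "\<And>x. u x \<le> norm (v x)"
    using schwartz_majorant[OF assms(2)] by blast
  define W where "W = {g \<in> O_M. OM_seminorm m v (\<lambda>x. g x - f x) < 1}"
  have "openin OM_topology W"
    unfolding W_def OM_topology_def
    by (rule topology_generated_by_Basis, rule CollectI, intro exI conjI, rule refl)
      (use v assms in simp_all)
  moreover have "OM_seminorm m v (\<lambda>x. f x - f x) \<le> 0"
    by (rule OM_seminorm_le) (simp add: nderiv_zero)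
  then have "f \<in> W"
    using assms by (simp add: W_def)
  moreover have "W \<subseteq> OM_nhd f m u"
  proof
    fix g assume g: "g \<in> W"
    have "u x * norm (nderiv j (\<lambda>x. g x - f x) x) \<le> 1" if "j \<le> m" for x j
    proof -
      have "u x * norm (nderiv j (\<lambda>x. g x - f x) x) \<le> norm (v x * nderiv j (\<lambda>x. g x - f x) x)"
        unfolding norm_mult by (intro mult_right_mono v) auto
      also have "\<dots> \<le> OM_seminorm m v (\<lambda>x. g x - f x)"
        using g assms that by (intro OM_seminorm_bounds v O_M_diff) (auto simp: W_def)
      also have "\<dots> \<le> 1"
        using g by (simp add: W_def)
      finally show ?thesis .
    qed
    then show "g \<in> OM_nhd f m u"
      using g by (auto simp: OM_nhd_def W_def)
  qed
  ultimately show ?thesis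
    by blast
qed

section \<open>Families on escaping sets\<close>

text \<open>Here \<open>n\<close> tends to infinity while \<open>x\<close> runs over all of
  \<open>A n\<close>, so eventual properties hold uniformly on \<open>A n\<close>.\<close>

definition tail :: "(nat \<Rightarrow> real set) \<Rightarrow> (nat \<times> real) filter" where
  "tail A = inf (filtercomap fst sequentially) (principal {(n, x). x \<in> A n})"

definition escaping :: "(nat \<Rightarrow> real set) \<Rightarrow> bool" where
  "escaping A \<longleftrightarrow> (\<forall>R. \<forall>\<^sub>F n in sequentially. \<forall>x\<in>A n. \<bar>x\<bar> > R)"

lemma eventually_tail:
  "(\<forall>\<^sub>F (n, x) in tail A. P n x) \<longleftrightarrow> (\<forall>\<^sub>F n in sequentially. \<forall>x\<in>A n. P n x)"
  unfolding tail_def eventually_inf_principal eventually_filtercomap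
  by (auto elim: eventually_mono)

lemma poly_bounded_tail_iff:
  "poly_bounded (tail A) q \<longleftrightarrow>
    (\<exists>C N. \<forall>\<^sub>F n in sequentially. \<forall>x\<in>A n. norm (q n x) \<le> C * (1 + \<bar>x\<bar>) ^ N)"
  unfolding poly_bounded_def eventually_tail ..

lemma tail_mono: "(\<And>n. A n \<subseteq> B n) \<Longrightarrow> tail A \<le> tail B"
  unfolding tail_def by (rule inf_mono) auto

text \<open>The decay of \<open>u\<close> is used with exponent \<open>N + 1\<close>, one more than
  the bound requires; the spare factor \<open>1 + |x|\<close> exceeds
  \<open>C * D / \<epsilon>\<close> once \<open>A n\<close> has escaped far enough.\<close>

lemma tail_small:
  assumes "escaping A" and "poly_bounded (tail A) q" and u: "rapid u" and "\<epsilon> > 0"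
  shows "\<forall>\<^sub>F n in sequentially. \<forall>x\<in>A n. u x * norm (q n x) \<le> \<epsilon>"
proof -
  obtain C N where C: "C \<ge> 0" "\<forall>\<^sub>F (n, x) in tail A. norm (q n x) \<le> C * (1 + \<bar>x\<bar>) ^ N"
    using poly_boundedE[OF assms(2)] .
  obtain D where D: "0 \<le> D" "\<And>x. u x * (1 + \<bar>x\<bar>) ^ (N + 1) \<le> D"
    using rapidE[OF u, of "N + 1"] by blast
  have "\<forall>\<^sub>F n in sequentially. \<forall>x\<in>A n. \<bar>x\<bar> > C * D / \<epsilon>"
    using assms(1) by (simp add: escaping_def)
  moreover have "\<forall>\<^sub>F n in sequentially. \<forall>x\<in>A n. norm (q n x) \<le> C * (1 + \<bar>x\<bar>) ^ N"
    using C(2) by (simp add: eventually_tail)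
  ultimately show ?thesis
  proof (eventually_elim, safe)
    fix n x
    assume *: "\<forall>x\<in>A n. \<bar>x\<bar> > C * D / \<epsilon>" "\<forall>x\<in>A n. norm (q n x) \<le> C * (1 + \<bar>x\<bar>) ^ N"
      and x: "x \<in> A n"
    have "(u x * norm (q n x)) * (1 + \<bar>x\<bar>) \<le> (u x * (C * (1 + \<bar>x\<bar>) ^ N)) * (1 + \<bar>x\<bar>)"
      using * x rapid_nonneg[OF u] by (intro mult_left_mono mult_right_mono) auto
    also have "\<dots> = C * (u x * (1 + \<bar>x\<bar>) ^ (N + 1))"
      by simp
    also have "\<dots> \<le> C * D"
      by (intro mult_left_mono D C)
    also have "\<dots> \<le> \<epsilon> * (1 + \<bar>x\<bar>)"
      using *(1) x assms(4) by (auto simp: divide_less_eq field_simps dest!: bspec)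
    finally show "u x * norm (q n x) \<le> \<epsilon>"
      by (rule mult_right_le_imp_le) simp
  qed
qed

text \<open>If no polynomial bound held, there would be points \<open>p N \<in> A (n N)\<close> going to infinity at which
  \<open>q\<close> exceeds \<open>N (1 + \<bar>p N\<bar>)^N\<close>; the weight below is supported on these points and
  decreases rapidly, but does not bound \<open>q\<close>.\<close>

lemma poly_bounded_tailI:
  assumes esc: "escaping A"
    and bd: "\<And>u. rapid u \<Longrightarrow> \<exists>C. \<forall>\<^sub>F n in sequentially. \<forall>x\<in>A n. u x * norm (q n x) \<le> C"
  shows "poly_bounded (tail A) q"
proof (rule ccontr)
  assume neg: "\<not> poly_bounded (tail A) q"
  have "\<exists>n p. n \<ge> N \<and> p \<in> A n \<and> \<bar>p\<bar> > real N \<and> norm (q n p) > real N * (1 + \<bar>p\<bar>) ^ N" for N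
  proof (rule ccontr)
    assume no: "\<not> ?thesis"
    have "\<forall>\<^sub>F n in sequentially. \<forall>x\<in>A n. \<bar>x\<bar> > real N"
      using esc by (simp add: escaping_def)
    then have "\<forall>\<^sub>F n in sequentially. \<forall>x\<in>A n. norm (q n x) \<le> real N * (1 + \<bar>x\<bar>) ^ N"
      using eventually_ge_at_top[of N]
      by eventually_elim (use no in \<open>meson not_less\<close>)
    then show False
      using neg unfolding poly_bounded_tail_iff by blast
  qed
  then obtain n p where np: "\<And>N. n N \<ge> N" "\<And>N. p N \<in> A (n N)" "\<And>N. \<bar>p N\<bar> > real N"
    "\<And>N. norm (q (n N) (p N)) > real N * (1 + \<bar>p N\<bar>) ^ N"
    by metis
  \<comment> \<open>The points \<open>p N\<close> may coincide for different \<open>N\<close>. The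
    least index gives the largest weight, so the lower bound \<open>u_ge\<close> holds for every
    \<open>N\<close>.\<close>
  define m where "m x = (LEAST N. p N = x)" for x
  have m: "p (m x) = x" "m x \<le> N" if "p N = x" for N x
    unfolding m_def using that by (auto intro: LeastI Least_le)
  define u where "u x = (if x \<in> range p then inverse ((1 + \<bar>x\<bar>) ^ m x) else 0)" for x
  have u_ge: "u (p N) * (1 + \<bar>p N\<bar>) ^ N \<ge> 1" for N
  proof -
    have "(1 + \<bar>p N\<bar>) ^ m (p N) \<le> (1 + \<bar>p N\<bar>) ^ N"
      using m(2)[of N] by (intro power_increasing) auto
    moreover have "(1 + \<bar>p N\<bar>) ^ m (p N) > 0"
      by (intro zero_less_power) auto
    ultimately show ?thesis
      by (simp add: u_def field_simps)
  qed
  have "rapid u"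
    unfolding rapid_def
  proof (intro conjI allI)
    show "0 \<le> u x" for x
      by (simp add: u_def)
    fix k
    \<comment> \<open>Points of index at least \<open>k\<close> contribute at most 1; the sum
      accounts for the finitely many points of smaller index.\<close>
    define B where "B = 1 + (\<Sum>N<k. (1 + \<bar>p N\<bar>) ^ k)"
    have "u x * (1 + \<bar>x\<bar>) ^ k \<le> B" for x
    proof (cases "x \<in> range p")
      case True
      then have x: "p (m x) = x"
        using m by blast
      show ?thesis
      proof (cases "m x < k")
        case True
        have "u x \<le> 1"
          by (auto simp: u_def inverse_le_1_iff)
        then have "u x * (1 + \<bar>x\<bar>) ^ k \<le> 1 * (1 + \<bar>p (m x)\<bar>) ^ k"
          unfolding x by (intro mult_right_mono) auto
        also have "\<dots> \<le> (\<Sum>N<k. (1 + \<bar>p N\<bar>) ^ k)"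
          unfolding mult_1 using True
          by (intro member_le_sum[where f = "\<lambda>N. (1 + \<bar>p N\<bar>) ^ k"]) auto
        finally show ?thesis
          by (simp add: B_def)
      next
        case False
        have "(1 + \<bar>x\<bar>) ^ k \<le> (1 + \<bar>x\<bar>) ^ m x"
          using False by (intro power_increasing) auto
        moreover have "(1 + \<bar>x\<bar>) ^ m x > 0"
          by (intro zero_less_power) auto
        ultimately have "u x * (1 + \<bar>x\<bar>) ^ k \<le> 1"
          by (simp add: u_def field_simps)
        also have "1 \<le> B"
          unfolding B_def by (auto intro: sum_nonneg)
        finally show ?thesis .
      qed
    next
      case False
      have "0 \<le> B"
        unfolding B_def by (auto intro!: add_nonneg_nonneg sum_nonneg)
      then show ?thesis
        using False by (simp add: u_def)
    qed
    then show "\<exists>C. \<forall>x. u x * (1 + \<bar>x\<bar>) ^ k \<le> C"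
      by blast
  qed
  from bd[OF this] obtain C n0 where C: "\<And>n x. n \<ge> n0 \<Longrightarrow> x \<in> A n \<Longrightarrow> u x * norm (q n x) \<le> C"
    unfolding eventually_sequentially by blast
  obtain N where N: "N \<ge> n0" "real N > C"
    by (meson dual_order.trans less_imp_le max.cobounded1 max.cobounded2 reals_Archimedean2
        of_nat_le_iff order.strict_trans2)
  have "C < real N * 1"
    using N by simp
  also have "\<dots> \<le> real N * (u (p N) * (1 + \<bar>p N\<bar>) ^ N)"
    by (intro mult_left_mono u_ge) auto
  also have "\<dots> = u (p N) * (real N * (1 + \<bar>p N\<bar>) ^ N)"
    by simp
  also have "\<dots> \<le> u (p N) * norm (q (n N) (p N))"
    using np(4)[of N] by (intro mult_left_mono) (auto simp: u_def)
  also have "\<dots> \<le> C"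
    using np(1,2)[of N] N by (intro C) auto
  finally show False
    by simp
qed

section \<open>Density of compactly supported functions\<close>

text \<open>Multiplying \<open>f\<close> by \<open>cutoff (x / (n + 1))\<close> changes it only
  where \<open>|x|\<close> is at least \<open>n + 1\<close>. The derivatives of these cutoffs are
  bounded uniformly in \<open>n\<close>, so the error is polynomially bounded on an escaping set and
  hence small for any weight.\<close>

lemma OM_open_contains_compact_support:
  assumes "openin OM_topology W" and "W \<noteq> {}"
  obtains f R where "f \<in> W" and "smooth f" and "\<And>y. \<bar>y\<bar> > R \<Longrightarrow> f y = 0"
proof -
  obtain f where fW: "f \<in> W"
    using assms(2) by blast
  then have f: "f \<in> O_M"
    using openin_subset[OF assms(1)] by (auto simp: topspace_OM_topology)
  obtain m u where u: "rapid u" "OM_nhd f m u \<subseteq> W"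
    using OM_open_contains_nhd[OF assms(1) fW] by blast
  define \<eta> where "\<eta> n = cutoff \<circ> (\<lambda>x. inverse (real (Suc n)) * x + 0)" for n
  define g where "g n x = \<eta> n x *\<^sub>R f x" for n x
  define A where "A n = {x. \<bar>x\<bar> \<ge> real n}" for n
  have sm\<eta>: "smooth (\<eta> n)" for n
    unfolding \<eta>_def by (intro smooth_compose smooth_cutoff smooth_affine)
  have smg: "smooth (g n)" for n
    unfolding g_def by (intro smooth_scaleR sm\<eta> O_M_smooth[OF f])
  have supp: "g n y = 0" if "\<bar>y\<bar> > 2 * real (Suc n)" for n y
    using that by (simp add: g_def \<eta>_def abs_mult cutoff_eq_0 field_simps)
  have eq1: "g n y = f y" if "\<bar>y\<bar> < real (Suc n)" for n y
    using that by (simp add: g_def \<eta>_def abs_mult cutoff_eq_1 field_simps)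
  have pb\<eta>: "poly_bounded (tail A) (\<lambda>n. nderiv j (\<eta> n))" for j
    unfolding \<eta>_def
  proof (rule poly_bounded_compose_derivs[OF smooth_cutoff smooth_affine])
    fix l
    have "\<exists>C\<ge>0. \<forall>x. norm (nderiv l cutoff x) \<le> C"
      by (rule compact_support_bounded_deriv[OF smooth_cutoff, of 2]) (simp add: cutoff_eq_0)
    then obtain C where "\<And>x. norm (nderiv l cutoff x) \<le> C"
      by blast
    then show "poly_bounded (tail A) (\<lambda>n x. nderiv l cutoff (inverse (real (Suc n)) * x + 0))"
      by (intro poly_bounded_bounded[where C = C] always_eventually) auto
    show "poly_bounded (tail A) (\<lambda>n. nderiv l (\<lambda>x. inverse (real (Suc n)) * x + 0))" if "1 \<le> l"
      using that unfolding nderiv_affine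
      by (intro poly_bounded_bounded[where C = 1] always_eventually) (auto simp: field_simps)
  qed
  have pbf: "poly_bounded (tail A) (\<lambda>n. nderiv j f)" for j
    using f by (rule poly_bounded_O_M)
  have "poly_bounded (tail A) (\<lambda>n x. nderiv j (g n) x + (-1) *\<^sub>R nderiv j f x)" for j
    unfolding g_def
    by (intro poly_bounded_add poly_bounded_scaleR poly_bounded_const pbf
        poly_bounded_scaleR_derivs sm\<eta> O_M_smooth[OF f] pb\<eta>)
  then have pb: "poly_bounded (tail A) (\<lambda>n. nderiv j (\<lambda>x. g n x - f x))" for j
    using nderiv_diff[OF smg O_M_smooth[OF f]] by simp
  have "escaping A"
    unfolding escaping_def A_def
  proof
    fix R
    obtain k where "real k > R"
      using reals_Archimedean2 by blast
    then show "\<forall>\<^sub>F n in sequentially. \<forall>x\<in>{x. real n \<le> \<bar>x\<bar>}. R < \<bar>x\<bar>"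
      by (intro eventually_sequentiallyI[of k]) auto
  qed
  then have "\<forall>j\<in>{..m}. \<forall>\<^sub>F n in sequentially. \<forall>x\<in>A n. u x * norm (nderiv j (\<lambda>x. g n x - f x) x) \<le> 1"
    using tail_small[OF _ pb u(1), of 1] by auto
  then have "\<forall>\<^sub>F n in sequentially. \<forall>j\<in>{..m}. \<forall>x\<in>A n. u x * norm (nderiv j (\<lambda>x. g n x - f x) x) \<le> 1"
    by (rule eventually_ball_finite[rotated]) simp
  then obtain n where n: "\<And>j x. j \<le> m \<Longrightarrow> x \<in> A n \<Longrightarrow> u x * norm (nderiv j (\<lambda>x. g n x - f x) x) \<le> 1"
    unfolding eventually_sequentially by fastforce
  have "g n \<in> OM_nhd f m u"
    unfolding OM_nhd_def
  proof (intro CollectI conjI allI impI)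
    show "g n \<in> O_M"
      using smg supp by (rule compact_support_O_M)
    fix x j assume j: "j \<le> m"
    show "u x * norm (nderiv j (\<lambda>x. g n x - f x) x) \<le> 1"
    proof (cases "x \<in> A n")
      case True
      then show ?thesis using n j by blast
    next
      case False
      have "open {y. \<bar>y\<bar> < real (Suc n)}"
        by (intro open_Collect_less continuous_intros)
      then have "nderiv j (\<lambda>x. g n x - f x) x = nderiv j (\<lambda>x. 0) x"
        by (rule nderiv_cong_open) (use False eq1 in \<open>auto simp: A_def\<close>)
      then show ?thesis
        by (simp add: nderiv_zero)
    qed
  qed
  then show ?thesis
    using that[of "g n" "2 * real (Suc n)"] u(2) smg supp by blast
qed

section \<open>Continuity of composition operators\<close>

text \<open>Since \<open>y = \<psi> x\<close> grows at most polynomially in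
  \<open>x = \<kappa> y\<close>, decay in \<open>x\<close> implies decay in \<open>y\<close>. Only
  the growth of \<open>\<psi>\<close> enters.\<close>

lemma rapid_compose_inverse:
  fixes \<psi> \<kappa> :: "real \<Rightarrow> real"
  assumes "\<psi> \<in> O_M" and "\<And>y. \<psi> (\<kappa> y) = y" and "rapid u"
  shows "rapid (u \<circ> \<kappa>)"
  unfolding rapid_def
proof (intro conjI allI)
  show "0 \<le> (u \<circ> \<kappa>) y" for y
    using assms(3) by (simp add: rapid_nonneg)
  fix N
  obtain C M where "\<And>x. norm (nderiv 0 \<psi> x) \<le> C * (1 + \<bar>x\<bar>) ^ M"
    using assms(1) unfolding O_M_iff by meson
  then have C: "\<bar>\<psi> x\<bar> \<le> C * (1 + \<bar>x\<bar>) ^ M" for x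
    by simp
  have Cpos: "0 \<le> C"
    using C[of 0] by simp
  obtain B where B: "\<And>x. u x * (1 + \<bar>x\<bar>) ^ (M * N) \<le> B"
    using rapidE[OF assms(3), of "M * N"] by blast
  have "(u \<circ> \<kappa>) y * (1 + \<bar>y\<bar>) ^ N \<le> (1 + C) ^ N * B" for y
  proof -
    define x where "x = \<kappa> y"
    have y: "y = \<psi> x"
      using assms(2) by (simp add: x_def)
    have "1 \<le> (1 + \<bar>x\<bar>) ^ M"
      by simp
    then have "1 + \<bar>y\<bar> \<le> (1 + C) * (1 + \<bar>x\<bar>) ^ M"
      unfolding distrib_right mult_1 y using C[of x] by linarith
    then have "u x * (1 + \<bar>y\<bar>) ^ N \<le> u x * ((1 + C) * (1 + \<bar>x\<bar>) ^ M) ^ N"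
      using rapid_nonneg[OF assms(3)] by (intro mult_left_mono power_mono) auto
    also have "\<dots> = (1 + C) ^ N * (u x * (1 + \<bar>x\<bar>) ^ (M * N))"
      unfolding power_mult_distrib power_mult by (simp only: mult_ac)
    also have "\<dots> \<le> (1 + C) ^ N * B"
      using Cpos by (intro mult_left_mono B) auto
    finally show ?thesis
      by (simp add: x_def)
  qed
  then show "\<exists>C. \<forall>x. (u \<circ> \<kappa>) x * (1 + \<bar>x\<bar>) ^ N \<le> C"
    by blast
qed

text \<open>The family indexed by all smooth \<open>d\<close> with \<open>\<bar>d\<^sup>(\<^sup>l\<^sup>)(\<psi> x)\<bar> \<le> 1\<close> turns the composition lemma
  into an estimate that is uniform in \<open>d\<close>.\<close>

lemma compose_deriv_bound:
  fixes \<psi> :: "real \<Rightarrow> real"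
  assumes "\<psi> \<in> O_M"
  obtains C N where "C \<ge> 1" and "\<And>(d :: real \<Rightarrow> complex) x j. smooth d \<Longrightarrow> j \<le> m \<Longrightarrow>
    (\<And>l. l \<le> m \<Longrightarrow> norm (nderiv l d (\<psi> x)) \<le> 1) \<Longrightarrow>
    norm (nderiv j (d \<circ> \<psi>) x) \<le> C * (1 + \<bar>x\<bar>) ^ N"
proof -
  \<comment> \<open>The composition lemma wants a smooth function at every index, so a non-smooth
    \<open>d\<close> is replaced by 0.\<close>
  define F where "F d = (if smooth d then d else (\<lambda>x. 0))" for d :: "real \<Rightarrow> complex"
  define G where "G = principal {(d, x). \<forall>l\<le>m. norm (nderiv l (F d) (\<psi> x)) \<le> 1}"
  have smF: "smooth (F d)" for d
    by (simp add: F_def)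
  have pb\<psi>: "poly_bounded G (\<lambda>_. nderiv l \<psi>)" for l
    using assms by (rule poly_bounded_O_M)
  have "poly_bounded G (\<lambda>d. nderiv j (F d \<circ> \<psi>))" if "j \<le> m" for j
    using that
    by (intro poly_bounded_compose_derivs smF O_M_smooth[OF assms] pb\<psi>
        poly_bounded_bounded[where C = 1]) (auto simp: G_def eventually_principal)
  then have "poly_bounded G (\<lambda>d x. \<Sum>j\<le>m. norm (nderiv j (F d \<circ> \<psi>) x))"
    by (intro poly_bounded_sum poly_bounded_norm) auto
  from poly_boundedE[OF this] obtain C N where CN:
    "\<forall>\<^sub>F (d, x) in G. norm (\<Sum>j\<le>m. norm (nderiv j (F d \<circ> \<psi>) x)) \<le> C * (1 + \<bar>x\<bar>) ^ N" "C \<ge> 0"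
    by blast
  have "norm (nderiv j (d \<circ> \<psi>) x) \<le> (1 + C) * (1 + \<bar>x\<bar>) ^ N"
    if "smooth d" "j \<le> m" "\<And>l. l \<le> m \<Longrightarrow> norm (nderiv l d (\<psi> x)) \<le> 1"
    for d :: "real \<Rightarrow> complex" and x j
  proof -
    have Fd: "F d = d"
      using that by (simp add: F_def)
    have "norm (nderiv j (d \<circ> \<psi>) x) \<le> (\<Sum>j\<le>m. norm (nderiv j (d \<circ> \<psi>) x))"
      using that by (intro member_le_sum) auto
    also have "\<dots> \<le> C * (1 + \<bar>x\<bar>) ^ N"
      using CN(1) that Fd by (auto simp: G_def eventually_principal sum_nonneg dest!: spec[of _ d])
    also have "\<dots> \<le> (1 + C) * (1 + \<bar>x\<bar>) ^ N"
      by (intro mult_right_mono) auto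
    finally show ?thesis .
  qed
  then show ?thesis
    using that[of "1 + C" N] CN(2) by simp
qed

lemma comp_op_continuous:
  fixes \<psi> :: "real \<Rightarrow> real"
  assumes \<psi>: "\<psi> \<in> O_M" and bij: "bij \<psi>"
  shows "continuous_map OM_topology OM_topology (comp_op \<psi>)"
  unfolding continuous_map_def topspace_OM_topology
proof (intro conjI allI impI)
  show "comp_op \<psi> \<in> O_M \<rightarrow> O_M"
    using \<psi> O_M_compose by (auto simp: comp_op_def)
  fix W assume W: "openin OM_topology W"
  show "openin OM_topology {h \<in> O_M. comp_op \<psi> h \<in> W}"
  proof (subst openin_subopen, safe)
    fix h assume h: "h \<in> O_M" "comp_op \<psi> h \<in> W"
    obtain m u where u: "rapid u" "OM_nhd (h \<circ> \<psi>) m u \<subseteq> W"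
      using OM_open_contains_nhd[OF W h(2)] by (auto simp: comp_op_def)
    obtain C N where C: "C \<ge> 1" and CN: "\<And>(d :: real \<Rightarrow> complex) x j. smooth d \<Longrightarrow> j \<le> m \<Longrightarrow>
      (\<And>l. l \<le> m \<Longrightarrow> norm (nderiv l d (\<psi> x)) \<le> 1) \<Longrightarrow>
      norm (nderiv j (d \<circ> \<psi>) x) \<le> C * (1 + \<bar>x\<bar>) ^ N"
      using compose_deriv_bound[OF \<psi>, of m] by blast
    define P where "P x = C * (1 + \<bar>x\<bar>) ^ N" for x :: real
    have P: "P x > 0" for x
      unfolding P_def using C by (intro mult_pos_pos zero_less_power) auto
    \<comment> \<open>At the point \<open>\<psi> x\<close> this weight equals
      \<open>u x * P x\<close>: the original weight enlarged by the loss incurred in the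
      composition.\<close>
    define u' where "u' = (\<lambda>x. u x * P x) \<circ> inv \<psi>"
    have "rapid u'"
      unfolding u'_def P_def using C bij
      by (intro rapid_compose_inverse[OF \<psi>] rapid_mult_poly u) (auto simp: bij_is_surj surj_f_inv_f)
    then obtain T where T: "openin OM_topology T" "h \<in> T" "T \<subseteq> OM_nhd h m u'"
      using OM_nhd_contains_open[OF h(1)] by blast
    have "T \<subseteq> {h \<in> O_M. comp_op \<psi> h \<in> W}"
    proof
      fix g assume "g \<in> T"
      then have g: "g \<in> OM_nhd h m u'" and gO: "g \<in> O_M"
        using T by (auto simp: OM_nhd_def)
      define d where "d x = g x - h x" for x
      have smd: "smooth d"
        unfolding d_def by (intro smooth_diff O_M_smooth gO h)
      have "u x * norm (nderiv j (\<lambda>x. (g \<circ> \<psi>) x - (h \<circ> \<psi>) x) x) \<le> 1" if j: "j \<le> m" for x j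
      proof -
        \<comment> \<open>By linearity the unit bound is applied to \<open>s *\<^sub>R d\<close> at
          this one point. As \<open>s\<close> may be 0, it is not divided by; only the positive
          \<open>P x\<close> is cancelled at the end.\<close>
        define s where "s = u x * P x"
        have s: "s \<ge> 0"
          using P[of x] rapid_nonneg[OF u(1)] by (simp add: s_def)
        have u'x: "u' (\<psi> x) = s"
          using bij by (simp add: u'_def s_def bij_is_inj)
        have nds: "nderiv l (\<lambda>x. s *\<^sub>R f x) = (\<lambda>x. s *\<^sub>R nderiv l f x)"
          if "smooth f" for l and f :: "real \<Rightarrow> complex"
          by (rule nderiv_linear[OF bounded_linear_scaleR_right that])
        have "norm (nderiv j ((\<lambda>x. s *\<^sub>R d x) \<circ> \<psi>) x) \<le> P x"
          unfolding P_def
        proof (rule CN[OF smooth_linear[OF bounded_linear_scaleR_right smd] j])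
          fix l assume "l \<le> m"
          then have "u' (\<psi> x) * norm (nderiv l d (\<psi> x)) \<le> 1"
            using g unfolding OM_nhd_def d_def by blast
          then show "norm (nderiv l (\<lambda>x. s *\<^sub>R d x) (\<psi> x)) \<le> 1"
            using s by (simp add: nds[OF smd] u'x)
        qed
        moreover have "(\<lambda>x. s *\<^sub>R d x) \<circ> \<psi> = (\<lambda>x. s *\<^sub>R (d \<circ> \<psi>) x)"
          by auto
        ultimately have "s * norm (nderiv j (d \<circ> \<psi>) x) \<le> P x"
          using s nds[OF smooth_compose[OF smd O_M_smooth[OF \<psi>]]] by simp
        then have "P x * (u x * norm (nderiv j (d \<circ> \<psi>) x)) \<le> P x * 1"
          by (simp add: s_def mult_ac)
        then have "u x * norm (nderiv j (d \<circ> \<psi>) x) \<le> 1"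
          using P[of x] by (rule mult_left_le_imp_le)
        then show ?thesis
          by (simp add: d_def o_def)
      qed
      then have "g \<circ> \<psi> \<in> OM_nhd (h \<circ> \<psi>) m u"
        using O_M_compose[OF gO \<psi>] by (auto simp: OM_nhd_def)
      then show "g \<in> {h \<in> O_M. comp_op \<psi> h \<in> W}"
        using u(2) gO by (auto simp: comp_op_def)
    qed
    then show "\<exists>T. openin OM_topology T \<and> h \<in> T \<and> T \<subseteq> {h \<in> O_M. comp_op \<psi> h \<in> W}"
      using T by blast
  qed
qed

lemma comp_op_continuous_linear:
  fixes \<psi> :: "real \<Rightarrow> real"
  assumes "\<psi> \<in> O_M" and "bij \<psi>"
  shows "continuous_linear_operator OM_topology (comp_op \<psi>)"
  using comp_op_continuous[OF assms]
  by (auto simp: continuous_linear_operator_def comp_op_def o_def)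

section \<open>Diffeomorphisms of the line without fixed points\<close>

lemma no_fixed_point_cases:
  fixes \<psi> :: "real \<Rightarrow> real"
  assumes "continuous_on UNIV \<psi>" and "\<And>x. \<psi> x \<noteq> x"
  shows "(\<forall>x. \<psi> x > x) \<or> (\<forall>x. \<psi> x < x)"
proof (rule ccontr)
  assume "\<not> ?thesis"
  then obtain p q where pq: "\<psi> p < p" "\<psi> q > q"
    using assms(2) by (metis linorder_neqE)
  have cont: "continuous_on S (\<lambda>x. \<psi> x - x)" for S
    using assms(1) by (intro continuous_intros) (rule continuous_on_subset, auto)
  have "connected (range (\<lambda>x. \<psi> x - x))"
    by (intro connected_continuous_image cont) auto
  then have "is_interval (range (\<lambda>x. \<psi> x - x))"
    by (simp add: is_interval_connected_1)
  from mem_is_interval_1_I[OF this rangeI[of _ p] rangeI[of _ q], of 0]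
  have "0 \<in> range (\<lambda>x. \<psi> x - x)"
    using pq by simp
  then obtain x where "0 = \<psi> x - x"
    by (rule rangeE)
  then have "\<psi> x = x"
    by simp
  then show False
    using assms(2) by blast
qed

text \<open>A continuous injection is strictly monotone, and a decreasing one would meet the
  diagonal: far enough to one side its values lie on the wrong side of the argument.\<close>

lemma no_fixed_point_strict_mono:
  fixes \<psi> :: "real \<Rightarrow> real"
  assumes cont: "continuous_on UNIV \<psi>" and fp: "\<And>x. \<psi> x \<noteq> x" and "inj \<psi>"
  shows "strict_mono \<psi>"
proof (rule strict_monoI, rule ccontr)
  fix x y :: real assume xy: "x < y" and "\<not> \<psi> x < \<psi> y"
  then have less: "\<psi> y < \<psi> x"
    using \<open>inj \<psi>\<close> by (metis injD less_irrefl linorder_neqE)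
  have mono: "(\<psi> a < \<psi> b \<and> \<psi> b < \<psi> c) \<or> (\<psi> c < \<psi> b \<and> \<psi> b < \<psi> a)" if "a < b" "b < c" for a b c
    using that assms by (intro continuous_inj_imp_mono) (auto intro: continuous_on_subset inj_on_subset)
  from no_fixed_point_cases[OF cont fp] show False
  proof
    assume up: "\<forall>x. \<psi> x > x"
    define z where "z = max y (\<psi> x) + 1"
    have z: "y < z" "\<psi> x < z"
      by (auto simp: z_def)
    have "\<psi> z < \<psi> x"
      using mono[OF xy z(1)] less by auto
    then show False
      using up[rule_format, of z] z by linarith
  next
    assume down: "\<forall>x. \<psi> x < x"
    define z where "z = min x (\<psi> y) - 1"
    have z: "z < x" "z < \<psi> y"
      by (auto simp: z_def)
    have "\<psi> y < \<psi> z"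
      using mono[OF z(1) xy] less by auto
    then show False
      using down[rule_format, of z] z by linarith
  qed
qed

lemma funpow_mono:
  fixes \<theta> :: "real \<Rightarrow> real"
  assumes "strict_mono \<theta>"
  shows "strict_mono (\<theta> ^^ n)"
  using assms by (induction n) (auto simp: strict_mono_def)

text \<open>A bounded increasing orbit would converge to a fixed point. Monotonicity carries the
  conclusion from \<open>c\<close> to all \<open>x \<ge> c\<close> uniformly.\<close>

lemma iterates_unbounded:
  fixes \<theta> :: "real \<Rightarrow> real"
  assumes cont: "continuous_on UNIV \<theta>" and mono: "strict_mono \<theta>" and up: "\<And>x. \<theta> x > x"
  shows "\<forall>\<^sub>F n in sequentially. \<forall>x\<ge>c. (\<theta> ^^ n) x > R"
proof -
  let ?a = "\<lambda>n. (\<theta> ^^ n) c"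
  have inc: "incseq ?a"
    using up by (intro incseq_SucI) (auto simp: less_imp_le)
  have "\<exists>n. ?a n > R"
  proof (rule ccontr)
    assume "\<not> ?thesis"
    then have "\<forall>n. ?a n \<le> R"
      by (simp add: not_less)
    then obtain L where L: "?a \<longlonglongrightarrow> L"
      using incseq_convergent[OF inc] by metis
    have "isCont \<theta> L"
      using cont by (simp add: continuous_on_eq_continuous_at)
    then have "(\<lambda>n. \<theta> (?a n)) \<longlonglongrightarrow> \<theta> L"
      using L by (rule isCont_tendsto_compose)
    moreover have "(\<lambda>n. \<theta> (?a n)) \<longlonglongrightarrow> L"
      using LIMSEQ_Suc[OF L] by simp
    ultimately have "\<theta> L = L"
      by (rule LIMSEQ_unique)
    then show False
      using up[of L] by simp
  qed
  then obtain n0 where n0: "?a n0 > R" ..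
  show ?thesis
  proof (rule eventually_sequentiallyI, safe)
    fix n x assume "n0 \<le> n" "c \<le> x"
    then have "?a n0 \<le> ?a n" "?a n \<le> (\<theta> ^^ n) x"
      using inc funpow_mono[OF mono, of n] by (auto simp: incseq_def strict_mono_less_eq)
    then show "R < (\<theta> ^^ n) x"
      using n0 by linarith
  qed
qed

lemma funpow_inverse:
  fixes \<theta> \<kappa> :: "'a \<Rightarrow> 'a"
  assumes "\<And>x. \<kappa> (\<theta> x) = x"
  shows "(\<kappa> ^^ n) ((\<theta> ^^ n) x) = x"
proof (induction n)
  case (Suc n)
  have "(\<kappa> ^^ Suc n) ((\<theta> ^^ Suc n) x) = (\<kappa> ^^ n) (\<kappa> (\<theta> ((\<theta> ^^ n) x)))"
    by (simp add: funpow_swap1)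
  then show ?case
    using assms Suc by simp
qed simp

text \<open>If \<open>\<theta> c \<le> d\<close>, then \<open>\<theta>\<close> maps
  \<open>[\<kappa> c, c]\<close> into \<open>[c, d]\<close> and \<open>\<kappa>\<close> does the
  same with \<open>[d, \<theta> d]\<close>, so the interval can grow at both ends. The property
  \<open>P\<close> is abstract because the lemma is used with \<open>\<psi>\<close> and its inverse
  in either role.\<close>

lemma fundamental_domain_exhaustion:
  fixes \<theta> \<kappa> :: "real \<Rightarrow> real"
  assumes cont: "continuous_on UNIV \<theta>" and mono: "strict_mono \<theta>" "strict_mono \<kappa>"
    and up: "\<And>x. \<theta> x > x" and inv: "\<And>x. \<kappa> (\<theta> x) = x" "\<And>x. \<theta> (\<kappa> x) = x"
    and sub: "\<And>J J'. P J \<Longrightarrow> J' \<subseteq> J \<Longrightarrow> P J'"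
    and un: "\<And>J J'. P J \<Longrightarrow> P J' \<Longrightarrow> P (J \<union> J')"
    and pre: "\<And>c d. P {c..d} \<Longrightarrow> P {y. \<theta> y \<in> {c..d}}" "\<And>c d. P {c..d} \<Longrightarrow> P {y. \<kappa> y \<in> {c..d}}"
    and "P {a..\<theta> a}"
  shows "P {-R..R}"
proof -
  have less: "\<kappa> x < \<kappa> y \<longleftrightarrow> x < y" "\<theta> x < \<theta> y \<longleftrightarrow> x < y" "\<kappa> x \<le> \<kappa> y \<longleftrightarrow> x \<le> y" "\<theta> x \<le> \<theta> y \<longleftrightarrow> x \<le> y" for x y
    using mono by (simp_all add: strict_mono_less strict_mono_less_eq)
  have step: "P {\<kappa> c..\<theta> d}" if "P {c..d}" "\<theta> c \<le> d" for c d
  proof (rule sub)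
    show "P ({y. \<theta> y \<in> {c..d}} \<union> ({c..d} \<union> {y. \<kappa> y \<in> {c..d}}))"
      using that pre by (intro un) auto
    show "{\<kappa> c..\<theta> d} \<subseteq> {y. \<theta> y \<in> {c..d}} \<union> ({c..d} \<union> {y. \<kappa> y \<in> {c..d}})"
    proof
      fix y assume y: "y \<in> {\<kappa> c..\<theta> d}"
      consider "y < c" | "y \<in> {c..d}" | "y > d"
        by force
      then show "y \<in> {y. \<theta> y \<in> {c..d}} \<union> ({c..d} \<union> {y. \<kappa> y \<in> {c..d}})"
      proof cases
        case 1
        then have "\<theta> (\<kappa> c) \<le> \<theta> y" "\<theta> y < \<theta> c"
          using y unfolding less by auto
        then show ?thesis
          using that inv by auto
      next
        case 3
        then have "\<kappa> y \<le> \<kappa> (\<theta> d)" "\<kappa> (\<theta> c) < \<kappa> y"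
          using y that unfolding less by auto
        then show ?thesis
          using inv by auto
      qed auto
    qed
  qed
  have "P {(\<kappa> ^^ M) a..(\<theta> ^^ Suc M) a} \<and> \<theta> ((\<kappa> ^^ M) a) \<le> (\<theta> ^^ Suc M) a" for M
  proof (induction M)
    case 0
    then show ?case
      using assms(11) by simp
  next
    case (Suc M)
    have "a \<le> (\<theta> ^^ n) a" for n
    proof (induction n)
      case (Suc n)
      then show ?case using up[of "(\<theta> ^^ n) a"] by simp
    qed simp
    moreover have "(\<kappa> ^^ n) a \<le> a" for n
    proof (induction n)
      case (Suc n)
      then show ?case using up[of "\<kappa> ((\<kappa> ^^ n) a)"] inv by simp
    qed simp
    ultimately have "(\<kappa> ^^ M) a \<le> (\<theta> ^^ Suc (Suc M)) a"
      by (rule order_trans[rotated])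
    then show ?case
      using step[of "(\<kappa> ^^ M) a" "(\<theta> ^^ Suc M) a"] Suc inv by simp
  qed
  \<comment> \<open>The first half pushes the upper end beyond \<open>R\<close>. The second, after
    applying the inverse iterate, puts the lower end below \<open>- R\<close>.\<close>
  moreover have "\<forall>\<^sub>F n in sequentially. (\<forall>x\<ge>a. (\<theta> ^^ n) x > R) \<and> (\<forall>x\<ge>-R. (\<theta> ^^ n) x > a)"
    by (intro eventually_conj iterates_unbounded cont mono up)
  then obtain M where M: "\<forall>x\<ge>a. (\<theta> ^^ M) x > R" "\<forall>x\<ge>-R. (\<theta> ^^ M) x > a"
    unfolding eventually_sequentially by blast
  have "(\<kappa> ^^ M) a \<le> - R"
  proof -
    have "(\<kappa> ^^ M) a \<le> (\<kappa> ^^ M) ((\<theta> ^^ M) (- R))"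
      using M(2) funpow_mono[OF mono(2), of M] by (auto simp: strict_mono_less_eq less_imp_le)
    then show ?thesis
      by (simp add: funpow_inverse[of \<kappa> \<theta>, OF inv(1)])
  qed
  moreover have "R \<le> (\<theta> ^^ Suc M) a"
    using M(1)[rule_format, of a] up[of "(\<theta> ^^ M) a"] by simp
  ultimately show ?thesis
    using sub[of "{(\<kappa> ^^ M) a..(\<theta> ^^ Suc M) a}" "{-R..R}"] by auto
qed

text \<open>The assumptions are symmetric in both maps, so each result holds for the inverse as well
  through \<open>swap\<close>. Membership in \<open>O_M\<close>, which is not symmetric, is kept out
  of the locale.\<close>

locale free_diffeo =
  fixes \<psi> \<kappa> :: "real \<Rightarrow> real"
  assumes smooth: "smooth \<psi>" "smooth \<kappa>"
    and inverse: "\<And>x. \<kappa> (\<psi> x) = x" "\<And>x. \<psi> (\<kappa> x) = x"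
    and no_fixed_point: "\<And>x. \<psi> x \<noteq> x"
begin

lemma swap: "free_diffeo \<kappa> \<psi>"
  using smooth inverse no_fixed_point by unfold_locales metis+

lemma inj: "inj \<psi>"
  using inverse by (metis injI)

lemma mono: "strict_mono \<psi>" "strict_mono \<kappa>"
proof -
  interpret s: free_diffeo \<kappa> \<psi> by (rule swap)
  show "strict_mono \<psi>" "strict_mono \<kappa>"
    using smooth_continuous smooth inj s.inj no_fixed_point s.no_fixed_point
    by (auto intro!: no_fixed_point_strict_mono)
qed

lemma cases: "(\<forall>x. \<psi> x > x) \<or> (\<forall>x. \<kappa> x > x)"
proof -
  have "(\<forall>x. \<psi> x > x) \<or> (\<forall>x. \<psi> x < x)"
    using smooth_continuous smooth no_fixed_point by (intro no_fixed_point_cases) auto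
  then show ?thesis
    using inverse by metis
qed

section \<open>Points that reach a given set after \<open>n\<close> steps\<close>

lemma smooth_iterate: "smooth (\<psi> ^^ n)"
  by (rule smooth_funpow[OF smooth(1)])

lemma iterate_inverse: "(\<kappa> ^^ n) ((\<psi> ^^ n) x) = x" "(\<psi> ^^ n) ((\<kappa> ^^ n) x) = x"
  using funpow_inverse inverse by metis+

definition entry :: "real set \<Rightarrow> nat \<Rightarrow> real set" where
  "entry J n = {x. (\<psi> ^^ n) x \<in> J}"

lemma entry_eq_image: "entry J n = (\<kappa> ^^ n) ` J"
proof (intro equalityI subsetI)
  fix x assume "x \<in> entry J n"
  then show "x \<in> (\<kappa> ^^ n) ` J"
    by (intro image_eqI[of _ _ "(\<psi> ^^ n) x"]) (simp_all add: entry_def iterate_inverse)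
qed (auto simp: entry_def iterate_inverse)

text \<open>If \<open>\<psi>\<close> moves points to the right, everything from \<open>- |R|\<close>
  on has passed \<open>d\<close> after many steps, so late arrivals start far to the left. In the
  other case the inverse iterates push the interval off to the right.\<close>

lemma escaping_entry: "escaping (entry {c..d})"
  unfolding escaping_def
proof
  fix R
  from cases show "\<forall>\<^sub>F n in sequentially. \<forall>x\<in>entry {c..d} n. \<bar>x\<bar> > R"
  proof
    assume "\<forall>x. \<psi> x > x"
    then have "\<forall>\<^sub>F n in sequentially. \<forall>x\<ge>-\<bar>R\<bar>. (\<psi> ^^ n) x > d"
      using smooth_continuous smooth mono by (intro iterates_unbounded) auto
    then show ?thesis
      by eventually_elim (force simp: entry_def not_le[symmetric])
  next
    assume "\<forall>x. \<kappa> x > x"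
    then have "\<forall>\<^sub>F n in sequentially. \<forall>x\<ge>c. (\<kappa> ^^ n) x > \<bar>R\<bar>"
      using smooth_continuous smooth mono by (intro iterates_unbounded) auto
    then show ?thesis
      by eventually_elim (force simp: entry_eq_image)
  qed
qed

text \<open>The first limit condition as a polynomial bound, for an arbitrary target set, so that
  the target can be shrunk, united and moved. Order 0 is absent because \<open>\<psi> ^^ n\<close>
  itself takes values in \<open>J\<close> on these points.\<close>

definition tame :: "real set \<Rightarrow> bool" where
  "tame J \<longleftrightarrow> (\<forall>k\<ge>1. poly_bounded (tail (entry J)) (\<lambda>n. nderiv k (\<psi> ^^ n)))"

lemma tame_subset:
  assumes "tame J" and "J' \<subseteq> J"
  shows "tame J'"
proof -
  have "tail (entry J') \<le> tail (entry J)"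
    using assms(2) by (intro tail_mono) (auto simp: entry_def)
  then show ?thesis
    using assms(1) poly_bounded_filter_mono unfolding tame_def by blast
qed

lemma tame_Un:
  assumes "tame J" and "tame J'"
  shows "tame (J \<union> J')"
proof -
  have "tail (entry (J \<union> J')) = sup (tail (entry J)) (tail (entry J'))"
    unfolding tail_def inf_sup_distrib1[symmetric] sup_principal
    by (intro arg_cong[where f = "\<lambda>S. inf _ (principal S)"]) (auto simp: entry_def)
  moreover have "poly_bounded (sup G G') q" if pq: "poly_bounded G q" "poly_bounded G' q"
    for G G' and q :: "nat \<Rightarrow> real \<Rightarrow> real"
  proof -
    obtain C N where q: "C \<ge> 0" "\<forall>\<^sub>F (i, x) in G. norm (q i x) \<le> C * (1 + \<bar>x\<bar>) ^ N"
      using poly_boundedE[OF pq(1)] .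
    obtain D M where r: "D \<ge> 0" "\<forall>\<^sub>F (i, x) in G'. norm (q i x) \<le> D * (1 + \<bar>x\<bar>) ^ M"
      using poly_boundedE[OF pq(2)] .
    have le: "C * (1 + \<bar>x\<bar>) ^ N \<le> (C + D) * (1 + \<bar>x\<bar>) ^ (N + M)"
      "D * (1 + \<bar>x\<bar>) ^ M \<le> (C + D) * (1 + \<bar>x\<bar>) ^ (N + M)" for x :: real
      using q(1) r(1) by (auto intro!: mult_mono power_increasing)
    have "\<forall>\<^sub>F (i, x) in G. norm (q i x) \<le> (C + D) * (1 + \<bar>x\<bar>) ^ (N + M)"
      using q(2) by eventually_elim (use le in \<open>auto intro: order_trans\<close>)
    moreover have "\<forall>\<^sub>F (i, x) in G'. norm (q i x) \<le> (C + D) * (1 + \<bar>x\<bar>) ^ (N + M)"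
      using r(2) by eventually_elim (use le in \<open>auto intro: order_trans\<close>)
    ultimately show ?thesis
      by (intro poly_boundedI[where C = "C + D" and N = "N + M"]) (simp add: eventually_sup)
  qed
  ultimately show ?thesis
    using assms by (simp add: tame_def)
qed

text \<open>One more step: \<open>\<psi> ^^ Suc n\<close> is \<open>\<psi>\<close> after
  \<open>\<psi> ^^ n\<close>, and the outer map is evaluated only on \<open>[c, d]\<close>.\<close>

lemma tame_image:
  assumes "tame {c..d}"
  shows "tame {y. \<kappa> y \<in> {c..d}}"
  unfolding tame_def
proof (intro allI impI)
  fix k :: nat assume k: "k \<ge> 1"
  have "poly_bounded (tail (entry {c..d})) (\<lambda>n. nderiv k (\<psi> \<circ> \<psi> ^^ n))"
  proof (rule poly_bounded_compose_derivs[OF smooth(1) smooth_iterate])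
    show "poly_bounded (tail (entry {c..d})) (\<lambda>n x. nderiv l \<psi> ((\<psi> ^^ n) x))" for l
      by (rule poly_bounded_deriv_on_interval[OF smooth(1), where c = c and d = d])
        (simp add: eventually_tail entry_def)
  qed (use assms in \<open>simp add: tame_def\<close>)
  then obtain C N where
    "\<forall>\<^sub>F n in sequentially. \<forall>x\<in>entry {c..d} n. norm (nderiv k (\<psi> ^^ Suc n) x) \<le> C * (1 + \<bar>x\<bar>) ^ N"
    unfolding poly_bounded_tail_iff by auto
  moreover have "entry {y. \<kappa> y \<in> {c..d}} (Suc n) = entry {c..d} n" for n
    by (simp add: entry_def inverse)
  ultimately have "\<forall>\<^sub>F n in sequentially. \<forall>x\<in>entry {y. \<kappa> y \<in> {c..d}} (Suc n).
      norm (nderiv k (\<psi> ^^ Suc n) x) \<le> C * (1 + \<bar>x\<bar>) ^ N"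
    by (simp only:)
  then show "poly_bounded (tail (entry {y. \<kappa> y \<in> {c..d}})) (\<lambda>n. nderiv k (\<psi> ^^ n))"
    unfolding poly_bounded_tail_iff
      eventually_sequentially_Suc[of "\<lambda>n. \<forall>x\<in>entry {y. \<kappa> y \<in> {c..d}} n.
      norm (nderiv k (\<psi> ^^ n) x) \<le> C * (1 + \<bar>x\<bar>) ^ N"] by blast
qed

text \<open>One step back: \<open>\<psi> ^^ n\<close> is \<open>\<kappa>\<close> after
  \<open>\<psi> ^^ Suc n\<close>. Here too the outer map is evaluated only on \<open>[c, d]\<close>,
  so the growth of \<open>\<kappa>\<close> does not matter.\<close>

lemma tame_preimage:
  assumes "tame {c..d}"
  shows "tame {y. \<psi> y \<in> {c..d}}"
  unfolding tame_def
proof (intro allI impI)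
  fix k :: nat assume k: "k \<ge> 1"
  define A where "A = entry {y. \<psi> y \<in> {c..d}}"
  have A: "A n = entry {c..d} (Suc n)" for n
    by (simp add: A_def entry_def)
  have "poly_bounded (tail A) (\<lambda>n. nderiv k (\<kappa> \<circ> \<psi> ^^ Suc n))"
  proof (rule poly_bounded_compose_derivs[OF smooth(2) smooth_iterate])
    show "poly_bounded (tail A) (\<lambda>n x. nderiv l \<kappa> ((\<psi> ^^ Suc n) x))" for l
      by (rule poly_bounded_deriv_on_interval[OF smooth(2), where c = c and d = d])
        (simp add: eventually_tail A_def entry_def)
    fix l :: nat assume "1 \<le> l"
    then obtain C N where "\<forall>\<^sub>F n in sequentially. \<forall>x\<in>entry {c..d} n.
        norm (nderiv l (\<psi> ^^ n) x) \<le> C * (1 + \<bar>x\<bar>) ^ N"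
      using assms unfolding tame_def poly_bounded_tail_iff by blast
    then have "\<forall>\<^sub>F n in sequentially. \<forall>x\<in>A n. norm (nderiv l (\<psi> ^^ Suc n) x) \<le> C * (1 + \<bar>x\<bar>) ^ N"
      unfolding A eventually_sequentially_Suc[of "\<lambda>n. \<forall>x\<in>entry {c..d} n.
        norm (nderiv l (\<psi> ^^ n) x) \<le> C * (1 + \<bar>x\<bar>) ^ N"] .
    then show "poly_bounded (tail A) (\<lambda>n. nderiv l (\<psi> ^^ Suc n))"
      unfolding poly_bounded_tail_iff by blast
  qed
  moreover have "\<kappa> \<circ> \<psi> ^^ Suc n = \<psi> ^^ n" for n
    by (auto simp: inverse)
  ultimately show "poly_bounded (tail A) (\<lambda>n. nderiv k (\<psi> ^^ n))"
    by (simp only:)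
qed

section \<open>Fundamental domains and the limit conditions\<close>

abbreviation segment :: "real \<Rightarrow> real set" where
  "segment a \<equiv> {min a (\<psi> a)..max a (\<psi> a)}"

text \<open>If \<open>\<psi>\<close> moves points to the left, the segment is
  \<open>[\<psi> a, a]\<close>, a fundamental domain of \<open>\<kappa>\<close> based at
  \<open>\<psi> a\<close>; images and preimages then exchange their roles.\<close>

lemma tame_fundamental_domain:
  assumes "tame (segment a)"
  shows "tame {c..d}"
proof -
  have "tame {-R..R}" for R
    using cases
  proof
    assume up: "\<forall>x. \<psi> x > x"
    then have "tame {a..\<psi> a}"
      using assms by (simp add: less_imp_le max_def min_def)
    from fundamental_domain_exhaustion[where P = tame, OF smooth_continuous[OF smooth(1)]
        mono up[rule_format] inverse tame_subset tame_Un tame_preimage tame_image this]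
    show ?thesis .
  next
    assume up: "\<forall>x. \<kappa> x > x"
    then have "tame {\<psi> a..\<kappa> (\<psi> a)}"
      using assms up[rule_format, of "\<psi> a"] by (simp add: inverse)
    from fundamental_domain_exhaustion[where P = tame, OF smooth_continuous[OF smooth(2)]
        mono(2,1) up[rule_format] inverse(2,1) tame_subset tame_Un tame_image tame_preimage this]
    show ?thesis .
  qed
  then show ?thesis
    by (rule tame_subset[of "{- max \<bar>c\<bar> \<bar>d\<bar>..max \<bar>c\<bar> \<bar>d\<bar>}"]) auto
qed

definition vanishing :: "real \<Rightarrow> bool" where
  "vanishing a \<longleftrightarrow> (\<forall>k\<ge>1. \<forall>v\<in>schwartz.
    (\<lambda>n. SUP x\<in>entry (segment a) n. norm (v x * of_real (nderiv k (\<psi> ^^ n) x))) \<longlonglongrightarrow> 0)"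

text \<open>Passing from suprema to points needs bounded value sets, which compactness of the
  inverse image of the segment provides; the converse needs nonempty sets. Rapid weights are reached
  through a Schwartz majorant.\<close>

lemma vanishing_iff_tame: "vanishing a \<longleftrightarrow> tame (segment a)"
proof
  let ?A = "entry (segment a)"
  assume van: "vanishing a"
  show "tame (segment a)"
    unfolding tame_def
  proof (intro allI impI poly_bounded_tailI escaping_entry)
    fix k :: nat and u assume k: "1 \<le> k" and u: "rapid u"
    obtain v where v: "v \<in> schwartz" "\<And>x. u x \<le> norm (v x)"
      using schwartz_majorant[OF u] by blast
    let ?q = "\<lambda>n x. norm (v x * of_real (nderiv k (\<psi> ^^ n) x))"
    have contv: "continuous_on S v" for S
    proof -
      have "v \<in> C_diff 0"
        using v(1) unfolding schwartz_def by blast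
      then show ?thesis
        using continuous_on_subset[of UNIV v S] by (simp add: C_diff_def)
    qed
    have bdd: "bdd_above (?q n ` ?A n)" for n
    proof -
      interpret s: free_diffeo \<kappa> \<psi> by (rule swap)
      have "compact (?A n)"
        unfolding entry_eq_image
        by (intro compact_continuous_image smooth_continuous s.smooth_iterate compact_Icc)
      then have "compact (?q n ` ?A n)"
        by (intro compact_continuous_image continuous_intros contv smooth_continuous_nderiv
            smooth_iterate)
      then show ?thesis
        by (intro bounded_imp_bdd_above compact_imp_bounded)
    qed
    have "(\<lambda>n. SUP x\<in>?A n. ?q n x) \<longlonglongrightarrow> 0"
      using van k v unfolding vanishing_def by blast
    \<comment> \<open>Boundedness suffices here: since it is known for every weight, the polynomial
      bound follows.\<close>
    then have "\<forall>\<^sub>F n in sequentially. (SUP x\<in>?A n. ?q n x) < 1"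
      by (rule order_tendstoD) simp
    then have "\<forall>\<^sub>F n in sequentially. \<forall>x\<in>?A n. u x * norm (nderiv k (\<psi> ^^ n) x) \<le> 1"
    proof (eventually_elim, safe)
      fix n x assume less: "(SUP x\<in>?A n. ?q n x) < 1" and x: "x \<in> ?A n"
      have "u x * norm (nderiv k (\<psi> ^^ n) x) \<le> ?q n x"
        unfolding norm_mult norm_of_real real_norm_def by (intro mult_right_mono v) auto
      also have "\<dots> \<le> (SUP x\<in>?A n. ?q n x)"
        by (rule cSUP_upper[OF x bdd])
      finally show "u x * norm (nderiv k (\<psi> ^^ n) x) \<le> 1"
        using less by linarith
    qed
    then show "\<exists>C. \<forall>\<^sub>F n in sequentially. \<forall>x\<in>?A n. u x * norm (nderiv k (\<psi> ^^ n) x) \<le> C"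
      by blast
  qed
next
  let ?A = "entry (segment a)"
  assume tame: "tame (segment a)"
  show "vanishing a"
    unfolding vanishing_def
  proof (intro allI impI ballI)
    fix k :: nat and v assume k: "1 \<le> k" and v: "v \<in> schwartz"
    let ?q = "\<lambda>n x. norm (v x * of_real (nderiv k (\<psi> ^^ n) x))"
    have ne: "?A n \<noteq> {}" for n
      by (simp add: entry_eq_image)
    show "(\<lambda>n. SUP x\<in>?A n. ?q n x) \<longlonglongrightarrow> 0"
    proof (rule tendstoI)
      fix e :: real assume e: "e > 0"
      have "\<forall>\<^sub>F n in sequentially. \<forall>x\<in>?A n. norm (v x) * norm (nderiv k (\<psi> ^^ n) x) \<le> e / 2"
        using tame k e by (intro tail_small escaping_entry schwartz_rapid v) (auto simp: tame_def)
      then show "\<forall>\<^sub>F n in sequentially. dist (SUP x\<in>?A n. ?q n x) 0 < e"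
      proof eventually_elim
        case (elim n)
        then have le: "?q n x \<le> e / 2" if "x \<in> ?A n" for x
          using that by (simp add: norm_mult)
        obtain x where x: "x \<in> ?A n"
          using ne[of n] by blast
        have "0 \<le> ?q n x"
          by simp
        also have "\<dots> \<le> (SUP x\<in>?A n. ?q n x)"
          by (rule cSUP_upper[OF x bdd_aboveI2[OF le]])
        finally have "0 \<le> (SUP x\<in>?A n. ?q n x)" .
        moreover have "(SUP x\<in>?A n. ?q n x) \<le> e / 2"
          by (intro cSUP_least ne le)
        ultimately show ?case
          using e by simp
      qed
    qed
  qed
qed

text \<open>Where \<open>\<psi> ^^ n\<close> leaves \<open>[- R, R]\<close> the composition vanishes
  on an open set, with all derivatives; the remaining points form an escaping set with polynomial
  bounds.\<close>

lemma compose_iterate_small: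
  assumes tame: "\<And>c d. tame {c..d}" and f: "smooth f" "\<And>y. \<bar>y\<bar> > R \<Longrightarrow> f y = 0" and u: "rapid u"
  shows "\<forall>\<^sub>F n in sequentially. \<forall>j\<le>m. \<forall>x. u x * norm (nderiv j (f \<circ> \<psi> ^^ n) x) \<le> 1"
proof -
  let ?A = "entry {-R..R}"
  have "poly_bounded (tail ?A) (\<lambda>n. nderiv j (f \<circ> \<psi> ^^ n))" for j
  proof (rule poly_bounded_compose_derivs[OF f(1) smooth_iterate])
    show "poly_bounded (tail ?A) (\<lambda>n x. nderiv l f ((\<psi> ^^ n) x))" for l
      by (rule poly_bounded_deriv_on_interval[OF f(1), where c = "-R" and d = R])
        (simp add: eventually_tail entry_def)
  qed (use tame in \<open>simp add: tame_def\<close>)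
  then have "\<forall>j\<in>{..m}. \<forall>\<^sub>F n in sequentially. \<forall>x\<in>?A n. u x * norm (nderiv j (f \<circ> \<psi> ^^ n) x) \<le> 1"
    using tail_small[OF escaping_entry _ u, of "-R" R _ 1] by auto
  then have "\<forall>\<^sub>F n in sequentially. \<forall>j\<in>{..m}. \<forall>x\<in>?A n. u x * norm (nderiv j (f \<circ> \<psi> ^^ n) x) \<le> 1"
    by (rule eventually_ball_finite[rotated]) simp
  then show ?thesis
  proof (eventually_elim, intro allI impI)
    fix n j x assume *: "\<forall>j\<in>{..m}. \<forall>x\<in>?A n. u x * norm (nderiv j (f \<circ> \<psi> ^^ n) x) \<le> 1" "j \<le> m"
    show "u x * norm (nderiv j (f \<circ> \<psi> ^^ n) x) \<le> 1"
    proof (cases "x \<in> ?A n")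
      case True
      then show ?thesis using * by auto
    next
      case False
      have "open {y. \<bar>(\<psi> ^^ n) y\<bar> > R}"
        by (intro open_Collect_less continuous_intros smooth_continuous smooth_iterate)
      then have "nderiv j (f \<circ> \<psi> ^^ n) x = nderiv j (\<lambda>x. 0) x"
        by (rule nderiv_cong_open) (use False f in \<open>auto simp: entry_def abs_if\<close>)
      then show ?thesis
        by (simp add: nderiv_zero)
    qed
  qed
qed

text \<open>The support is contained in a compact set, the image of \<open>[- R, R]\<close> under
  \<open>\<kappa> ^^ n\<close>. Applied to the inverse, this puts the second summand of the mixing
  witness into \<open>O_M\<close>.\<close>

lemma compose_iterate_O_M:
  assumes "smooth f" and "\<And>y. \<bar>y\<bar> > R \<Longrightarrow> f y = 0"
  shows "f \<circ> \<psi> ^^ n \<in> O_M"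
proof -
  interpret s: free_diffeo \<kappa> \<psi> by (rule swap)
  have "compact (entry {-R..R} n)"
    unfolding entry_eq_image
    by (intro compact_continuous_image smooth_continuous s.smooth_iterate compact_Icc)
  then obtain B where B: "\<And>x. x \<in> entry {-R..R} n \<Longrightarrow> norm x \<le> B"
    by (meson bounded_iff compact_imp_bounded)
  have "(f \<circ> \<psi> ^^ n) y = 0" if "\<bar>y\<bar> > B" for y
  proof -
    have "y \<notin> entry {-R..R} n"
      using B[of y] that by auto
    then show ?thesis
      using assms(2) by (auto simp: entry_def abs_if)
  qed
  then show ?thesis
    using smooth_compose[OF assms(1) smooth_iterate] by (rule compact_support_O_M[rotated])
qed

end

lemma comp_op_funpow: "(comp_op \<psi> ^^ n) f = f \<circ> \<psi> ^^ n"
  by (induction n arbitrary: f) (auto simp: comp_op_def o_assoc funpow_swap1 o_def)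

section \<open>Functions with small iterates\<close>

text \<open>The leading term of the \<open>k\<close>-th derivative of \<open>H \<circ> \<Phi>\<close> is \<open>\<Phi>\<^sup>(\<^sup>k\<^sup>) \<cdot> H'(\<Phi>)\<close> with
  \<open>\<bar>H'\<bar> \<ge> 1/2\<close>, and the remaining terms only involve lower derivatives of \<open>\<Phi>\<close>.\<close>

lemma poly_bounded_derivs_from_approx:
  assumes sm: "\<And>n. smooth (\<Phi> n)" and esc: "escaping A"
    and maps: "\<And>n x. x \<in> A n \<Longrightarrow> \<Phi> n x \<in> I"
    and approx: "\<And>k u. rapid u \<Longrightarrow> \<exists>H :: nat \<Rightarrow> real \<Rightarrow> complex. (\<forall>n. smooth (H n)) \<and>
      (\<forall>\<^sub>F n in sequentially. (\<forall>j\<le>k. \<forall>x. u x * norm (nderiv j (H n \<circ> \<Phi> n) x) \<le> 1) \<and>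
        (\<forall>j\<le>k. \<forall>y\<in>I. norm (nderiv j (H n) y - nderiv j complex_of_real y) \<le> 1 / 2))"
  shows "k \<ge> 1 \<Longrightarrow> poly_bounded (tail A) (\<lambda>n. nderiv k (\<Phi> n))"
proof (induction k rule: less_induct)
  case (less k)
  then obtain p where k: "k = Suc p"
    by (cases k) auto
  have smI: "smooth (\<lambda>x::real. x)"
    using smooth_affine[of 1 0] by simp
  have ndof: "nderiv l complex_of_real y = (if l = 1 then 1 else 0)" if "l \<ge> 1" for l y
    using nderiv_linear[OF bounded_linear_of_real[where 'a = complex] smI, of l] nderiv_affine[of l 1 0] that
    by auto
  show ?case
  proof (rule poly_bounded_tailI[OF esc])
    fix u assume u: "rapid u"
    obtain H where smH: "\<And>n. smooth (H n)"
      and H: "\<forall>\<^sub>F n in sequentially. (\<forall>j\<le>k. \<forall>x. u x * norm (nderiv j (H n \<circ> \<Phi> n) x) \<le> 1) \<and>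
        (\<forall>j\<le>k. \<forall>y\<in>I. norm (nderiv j (H n) y - nderiv j complex_of_real y) \<le> 1 / 2)"
      using approx[OF u, of k] by blast
    define r where "r n x = (\<Sum>i<p. real (p choose Suc i) *\<^sub>R
      (nderiv (p - i) (\<Phi> n) x *\<^sub>R nderiv (Suc i) (nderiv 1 (H n) \<circ> \<Phi> n) x))" for n x
    have split: "nderiv k (H n \<circ> \<Phi> n) x = nderiv k (\<Phi> n) x *\<^sub>R nderiv 1 (H n) (\<Phi> n x) + r n x" for n x
      unfolding k nderiv_Suc_compose[OF smH sm]
      by (subst sum.atMost_shift) (simp add: r_def del: nderiv.simps(2))
    have "poly_bounded (tail A) (\<lambda>n x. nderiv l (nderiv 1 (H n)) (\<Phi> n x))" if "l \<le> p" for l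
    \<comment> \<open>Derivatives of the identity of order at least 1 are bounded by 1, and the
      approximation error is at most \<open>1 / 2\<close>.\<close>
    proof (rule poly_bounded_bounded[where C = "3 / 2"])
      have le: "norm (nderiv (Suc l) (H n) y) \<le> 3 / 2"
        if "norm (nderiv (Suc l) (H n) y - nderiv (Suc l) complex_of_real y) \<le> 1 / 2" for n y
      proof -
        have "norm (nderiv (Suc l) complex_of_real y) \<le> 1"
          using ndof[of "Suc l" y] by (simp del: nderiv.simps)
        then show ?thesis
          using that norm_triangle_sub[of "nderiv (Suc l) (H n) y" "nderiv (Suc l) complex_of_real y"]
          by linarith
      qed
      show "\<forall>\<^sub>F (n, x) in tail A. norm (nderiv l (nderiv 1 (H n)) (\<Phi> n x)) \<le> 3 / 2"
        unfolding eventually_tail nderiv_Suc_right[symmetric] using H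
        by eventually_elim (use le maps that k in blast)
    qed
    moreover have lower: "poly_bounded (tail A) (\<lambda>n. nderiv l (\<Phi> n))" if "1 \<le> l" "l \<le> p" for l
      using less.IH[of l] that k by simp
    ultimately have "poly_bounded (tail A) (\<lambda>n. nderiv i (nderiv 1 (H n) \<circ> \<Phi> n))" if "i \<le> p" for i
      using that by (intro poly_bounded_compose_derivs smooth_nderiv smH sm) auto
    then have "poly_bounded (tail A) r"
      unfolding r_def
      by (intro poly_bounded_sum poly_bounded_scaleR poly_bounded_const lower)
        (auto simp del: nderiv.simps One_nat_def)
    then have "\<forall>\<^sub>F n in sequentially. \<forall>x\<in>A n. u x * norm (r n x) \<le> 1"
      by (intro tail_small esc u) auto
    \<comment> \<open>The weighted composition and the weighted remainder are each at most 1;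
      dividing by the lower bound \<open>1 / 2\<close> of the first derivative of \<open>H n\<close>
      gives 4.\<close>
    then have "\<forall>\<^sub>F n in sequentially. \<forall>x\<in>A n. u x * norm (nderiv k (\<Phi> n) x) \<le> 4"
      using H
    proof (eventually_elim, intro ballI)
      fix n x
      assume r: "\<forall>x\<in>A n. u x * norm (r n x) \<le> 1"
        and H: "(\<forall>j\<le>k. \<forall>x. u x * norm (nderiv j (H n \<circ> \<Phi> n) x) \<le> 1) \<and>
          (\<forall>j\<le>k. \<forall>y\<in>I. norm (nderiv j (H n) y - nderiv j complex_of_real y) \<le> 1 / 2)"
        and x: "x \<in> A n"
      let ?D = "nderiv k (\<Phi> n) x" and ?h = "nderiv 1 (H n) (\<Phi> n x)"
      have u0: "u x \<ge> 0"
        by (rule rapid_nonneg[OF u])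
      have "norm (?h - nderiv 1 complex_of_real (\<Phi> n x)) \<le> 1 / 2"
        using H[THEN conjunct2, rule_format, of 1, OF _ maps[OF x]] k by simp
      then have "norm (?h - 1) \<le> 1 / 2"
        using ndof[of 1] by (simp del: nderiv.simps One_nat_def)
      then have "norm ?h \<ge> 1 / 2"
        using norm_triangle_ineq2[of 1 "1 - ?h"] by (simp add: norm_minus_commute)
      then have "u x * norm ?D * (1 / 2) \<le> u x * norm ?D * norm ?h"
        using u0 by (intro mult_left_mono) auto
      also have "\<dots> = u x * norm (nderiv k (H n \<circ> \<Phi> n) x - r n x)"
        by (simp add: split)
      also have "\<dots> \<le> u x * (norm (nderiv k (H n \<circ> \<Phi> n) x) + norm (r n x))"
        by (intro mult_left_mono norm_triangle_ineq4 u0)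
      also have "\<dots> \<le> 1 + 1"
        unfolding distrib_left using H r x by (intro add_mono) auto
      finally show "u x * norm ?D \<le> 4"
        by simp
    qed
    then show "\<exists>C. \<forall>\<^sub>F n in sequentially. \<forall>x\<in>A n. u x * norm (nderiv k (\<Phi> n) x) \<le> C"
      by blast
  qed
qed

section \<open>Mixing\<close>

lemma mixing_nhds:
  assumes "mixing OM_topology (comp_op \<psi>)"
    and "f \<in> O_M" and "g \<in> O_M" and "rapid u" and "rapid w"
  shows "\<forall>\<^sub>F n in sequentially. \<exists>h. h \<in> OM_nhd f k u \<and> h \<circ> \<psi> ^^ n \<in> OM_nhd g k w"
proof -
  obtain U where U: "openin OM_topology U" "f \<in> U" "U \<subseteq> OM_nhd f k u"
    using OM_nhd_contains_open[OF assms(2,4)] by blast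
  obtain V where V: "openin OM_topology V" "g \<in> V" "V \<subseteq> OM_nhd g k w"
    using OM_nhd_contains_open[OF assms(3,5)] by blast
  have "\<forall>\<^sub>F n in sequentially. (comp_op \<psi> ^^ n) ` U \<inter> V \<noteq> {}"
    using assms(1) U V unfolding mixing_def by blast
  then show ?thesis
  proof eventually_elim
    case (elim n)
    then obtain h where "h \<in> U" "(comp_op \<psi> ^^ n) h \<in> V"
      by blast
    then show ?case
      using U V unfolding comp_op_funpow by blast
  qed
qed

section \<open>Necessary conditions on the symbol\<close>

lemma OM_nhdD:
  "g \<in> OM_nhd f k u \<Longrightarrow> j \<le> k \<Longrightarrow> u x * norm (nderiv j (\<lambda>x. g x - f x) x) \<le> 1"
  by (simp add: OM_nhd_def)

lemma mixing_pointwise: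
  fixes f g :: "real \<Rightarrow> complex"
  assumes "mixing OM_topology (comp_op \<psi>)" and "f \<in> O_M" and "g \<in> O_M" and "\<epsilon> > 0"
  obtains n h where "n \<ge> 1" and "h \<in> O_M" and "h \<circ> \<psi> ^^ n \<in> O_M"
    and "\<And>x j. j \<le> k \<Longrightarrow> \<bar>x\<bar> \<le> R \<Longrightarrow> norm (nderiv j (\<lambda>x. h x - f x) x) \<le> \<epsilon>"
    and "\<And>x j. j \<le> k \<Longrightarrow> \<bar>x\<bar> \<le> R \<Longrightarrow> norm (nderiv j (\<lambda>x. (h \<circ> \<psi> ^^ n) x - g x) x) \<le> \<epsilon>"
proof -
  let ?u = "\<lambda>x. if \<bar>x\<bar> \<le> R then 1 / \<epsilon> else 0"
  have "rapid ?u"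
    using assms(4) by (intro rapid_indicator) auto
  from mixing_nhds[OF assms(1-3) this this, of k]
  obtain n0 where n0: "\<And>n. n \<ge> n0 \<Longrightarrow> \<exists>h. h \<in> OM_nhd f k ?u \<and> h \<circ> \<psi> ^^ n \<in> OM_nhd g k ?u"
    unfolding eventually_sequentially by blast
  \<comment> \<open>A successor is chosen so that at least one factor \<open>\<psi>\<close> can be
    split off.\<close>
  obtain h where h: "h \<in> OM_nhd f k ?u" "h \<circ> \<psi> ^^ Suc n0 \<in> OM_nhd g k ?u"
    using n0[of "Suc n0"] by auto
  have le: "norm (nderiv j (\<lambda>x. q x - q' x) x) \<le> \<epsilon>"
    if "q \<in> OM_nhd q' k ?u" "j \<le> k" "\<bar>x\<bar> \<le> R" for q q' j x
    using OM_nhdD[OF that(1,2), of x] that(3) assms(4) by (simp add: field_simps)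
  show ?thesis
    using h le[OF h(1)] le[OF h(2)] by (intro that[of "Suc n0" h]) (auto simp: OM_nhd_def)
qed

text \<open>For \<open>n \<ge> 1\<close> every \<open>h \<circ> \<psi> ^^ n\<close> takes equal
  values at \<open>x\<close> and \<open>y\<close>, so it cannot be within a third of their distance
  of the identity at both points.\<close>

lemma mixing_inj:
  assumes "mixing OM_topology (comp_op \<psi>)"
  shows "inj \<psi>"
proof (rule injI, rule ccontr)
  fix x y assume eq: "\<psi> x = \<psi> y" and ne: "x \<noteq> y"
  have pos: "\<bar>x - y\<bar> / 3 > 0"
    using ne by simp
  obtain n and h :: "real \<Rightarrow> complex" where n: "n \<ge> 1" and "h \<in> O_M" "h \<circ> \<psi> ^^ n \<in> O_M"
    and "\<And>z j. j \<le> 0 \<Longrightarrow> \<bar>z\<bar> \<le> max \<bar>x\<bar> \<bar>y\<bar> \<Longrightarrow> norm (nderiv j (\<lambda>z. h z - 0) z) \<le> \<bar>x - y\<bar> / 3"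
    and h: "\<And>z j. j \<le> 0 \<Longrightarrow> \<bar>z\<bar> \<le> max \<bar>x\<bar> \<bar>y\<bar> \<Longrightarrow>
      norm (nderiv j (\<lambda>z. (h \<circ> \<psi> ^^ n) z - complex_of_real z) z) \<le> \<bar>x - y\<bar> / 3"
    by (rule mixing_pointwise[OF assms O_M_const[of 0] O_M_of_real[OF O_M_ident] pos,
          where k = 0 and R = "max \<bar>x\<bar> \<bar>y\<bar>"]) blast
  obtain p where "n = Suc p"
    using n by (cases n) auto
  then have "(h \<circ> \<psi> ^^ n) x = (h \<circ> \<psi> ^^ n) y"
    using eq by (simp add: funpow_swap1)
  then have "norm (complex_of_real x - complex_of_real y) \<le> \<bar>x - y\<bar> / 3 + \<bar>x - y\<bar> / 3"
    using h[of 0 x] h[of 0 y] norm_triangle_ineq4[of "(h \<circ> \<psi> ^^ n) y - complex_of_real y"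
        "(h \<circ> \<psi> ^^ n) x - complex_of_real x"] by simp
  moreover have "norm (complex_of_real x - complex_of_real y) = \<bar>x - y\<bar>"
    by (metis norm_of_real of_real_diff)
  ultimately show False
    using ne by simp
qed

text \<open>For \<open>n \<ge> 1\<close> the derivative of \<open>h \<circ> \<psi> ^^ n\<close>
  vanishes at a critical point of \<open>\<psi>\<close>, while that of the identity is 1.\<close>

lemma mixing_deriv_nonzero:
  assumes "mixing OM_topology (comp_op \<psi>)" and sm: "smooth \<psi>"
  shows "nderiv 1 \<psi> x \<noteq> 0"
proof
  assume z: "nderiv 1 \<psi> x = 0"
  obtain n and h :: "real \<Rightarrow> complex" where n: "n \<ge> 1" and hO: "h \<in> O_M" "h \<circ> \<psi> ^^ n \<in> O_M"
    and "\<And>z j. j \<le> 1 \<Longrightarrow> \<bar>z\<bar> \<le> \<bar>x\<bar> \<Longrightarrow> norm (nderiv j (\<lambda>z. h z - 0) z) \<le> 1 / 2"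
    and h: "\<And>z j. j \<le> 1 \<Longrightarrow> \<bar>z\<bar> \<le> \<bar>x\<bar> \<Longrightarrow>
      norm (nderiv j (\<lambda>z. (h \<circ> \<psi> ^^ n) z - complex_of_real z) z) \<le> 1 / 2"
    by (rule mixing_pointwise[OF assms(1) O_M_const[of 0] O_M_of_real[OF O_M_ident],
          where \<epsilon> = "1 / 2" and k = 1 and R = "\<bar>x\<bar>"]) auto
  obtain p where p: "n = Suc p"
    using n by (cases n) auto
  have "h \<circ> \<psi> ^^ n = (h \<circ> \<psi> ^^ p) \<circ> \<psi>"
    unfolding p by (simp only: funpow_Suc_right o_assoc)
  then have "nderiv 1 (h \<circ> \<psi> ^^ n) x = 0"
    using nderiv_1_compose[OF smooth_compose[OF O_M_smooth[OF hO(1)] smooth_funpow[OF sm]] sm, of p] z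
    by (simp del: nderiv.simps One_nat_def)
  moreover have "nderiv 1 (\<lambda>z. (h \<circ> \<psi> ^^ n) z - complex_of_real z) x =
      nderiv 1 (h \<circ> \<psi> ^^ n) x - nderiv 1 (\<lambda>z. complex_of_real z) x"
    using hO O_M_of_real[OF O_M_ident] by (subst nderiv_diff) (auto dest!: O_M_smooth)
  moreover have "nderiv 1 (\<lambda>z. complex_of_real z) x = 1"
    using nderiv_linear[OF bounded_linear_of_real[where 'a = complex] O_M_smooth[OF O_M_ident], of 1] nderiv_affine[of 1 1 0]
    by (simp del: nderiv.simps)
  ultimately show False
    using h[of 1 x] by (simp del: nderiv.simps One_nat_def)
qed

text \<open>At a fixed point \<open>h\<close> and \<open>h \<circ> \<psi> ^^ n\<close> agree, so one
  cannot be near 0 and the other near 1.\<close>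

lemma mixing_no_fixed_point:
  assumes "mixing OM_topology (comp_op \<psi>)"
  shows "\<psi> x \<noteq> x"
proof
  assume eq: "\<psi> x = x"
  obtain n and h :: "real \<Rightarrow> complex" where "n \<ge> 1" "h \<in> O_M" "h \<circ> \<psi> ^^ n \<in> O_M"
    and h: "\<And>z j. j \<le> 0 \<Longrightarrow> \<bar>z\<bar> \<le> \<bar>x\<bar> \<Longrightarrow> norm (nderiv j (\<lambda>z. h z - 0) z) \<le> 1 / 3"
    "\<And>z j. j \<le> 0 \<Longrightarrow> \<bar>z\<bar> \<le> \<bar>x\<bar> \<Longrightarrow> norm (nderiv j (\<lambda>z. (h \<circ> \<psi> ^^ n) z - 1) z) \<le> 1 / 3"
    by (rule mixing_pointwise[OF assms(1) O_M_const[of 0] O_M_const[of 1],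
          where \<epsilon> = "1 / 3" and k = 0 and R = "\<bar>x\<bar>"]) auto
  have "(\<psi> ^^ n) x = x"
    using eq by (induction n) auto
  then have "norm (h x) \<le> 1 / 3" "norm (h x - 1) \<le> 1 / 3"
    using h[of 0 x] by simp_all
  then show False
    using norm_triangle_ineq4[of "h x" "h x - 1"] by simp
qed

section \<open>Mixing and polynomial bounds for free diffeomorphisms\<close>

context free_diffeo
begin

lemma mixing_if_tame:
  assumes "\<psi> \<in> O_M" and tame: "tame (segment a)" and tame': "free_diffeo.tame \<kappa> J"
    and J: "J = {min b (\<kappa> b)..max b (\<kappa> b)}"
  shows "mixing OM_topology (comp_op \<psi>)"
  unfolding mixing_def
proof (intro conjI allI impI)
  interpret s: free_diffeo \<kappa> \<psi> by (rule swap)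
  have bij: "bij \<psi>"
    using inverse by (intro o_bij[where g = \<kappa>]) auto
  then show "continuous_linear_operator OM_topology (comp_op \<psi>)"
    by (rule comp_op_continuous_linear[OF assms(1)])
  fix U V assume "openin OM_topology U \<and> U \<noteq> {} \<and> openin OM_topology V \<and> V \<noteq> {}"
  then have U: "openin OM_topology U" "U \<noteq> {}" and V: "openin OM_topology V" "V \<noteq> {}"
    by auto
  obtain f R where f: "f \<in> U" "smooth f" "\<And>y. \<bar>y\<bar> > R \<Longrightarrow> f y = 0"
    using OM_open_contains_compact_support[OF U] by blast
  obtain g S where g: "g \<in> V" "smooth g" "\<And>y. \<bar>y\<bar> > S \<Longrightarrow> g y = 0"
    using OM_open_contains_compact_support[OF V] by blast
  have O: "f \<in> O_M" "g \<in> O_M" "f \<circ> \<psi> ^^ n \<in> O_M" "g \<circ> \<kappa> ^^ n \<in> O_M" for n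
    using f g by (auto intro: compact_support_O_M compose_iterate_O_M s.compose_iterate_O_M)
  obtain m u where u: "rapid u" "OM_nhd f m u \<subseteq> U"
    using OM_open_contains_nhd[OF U(1) f(1)] by blast
  obtain m' w where w: "rapid w" "OM_nhd g m' w \<subseteq> V"
    using OM_open_contains_nhd[OF V(1) g(1)] by blast
  have "\<forall>\<^sub>F n in sequentially. \<forall>j\<le>m'. \<forall>x. w x * norm (nderiv j (f \<circ> \<psi> ^^ n) x) \<le> 1"
    by (rule compose_iterate_small[OF tame_fundamental_domain[OF tame] f(2,3) w(1)])
  moreover have "\<forall>\<^sub>F n in sequentially. \<forall>j\<le>m. \<forall>x. u x * norm (nderiv j (g \<circ> \<kappa> ^^ n) x) \<le> 1"
    by (rule s.compose_iterate_small[OF s.tame_fundamental_domain[OF tame'[unfolded J]] g(2,3) u(1)])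
  ultimately show "\<forall>\<^sub>F n in sequentially. (comp_op \<psi> ^^ n) ` U \<inter> V \<noteq> {}"
  proof eventually_elim
    case (elim n)
    \<comment> \<open>The second summand is small; after \<open>n\<close> steps the first becomes
      small and the second becomes \<open>g\<close>.\<close>
    define h where "h x = f x + (g \<circ> \<kappa> ^^ n) x" for x
    have "h \<in> O_M"
      unfolding h_def by (intro O_M_add O)
    moreover have "(\<lambda>x. h x - f x) = g \<circ> \<kappa> ^^ n"
      by (auto simp: h_def)
    ultimately have "h \<in> U"
      using elim(2) u(2) by (auto simp: OM_nhd_def)
    moreover have hn: "h \<circ> \<psi> ^^ n = (\<lambda>x. (f \<circ> \<psi> ^^ n) x + g x)"
      by (auto simp: h_def iterate_inverse)
    have "h \<circ> \<psi> ^^ n \<in> O_M"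
      unfolding hn by (intro O_M_add O)
    moreover have "(\<lambda>x. (h \<circ> \<psi> ^^ n) x - g x) = f \<circ> \<psi> ^^ n"
      unfolding hn by auto
    ultimately have "h \<circ> \<psi> ^^ n \<in> V"
      using elim(1) w(2) unfolding OM_nhd_def by auto
    then show ?case
      using \<open>h \<in> U\<close> comp_op_funpow[where \<psi> = \<psi> and n = n and f = h] by force
  qed
qed

lemma tame_if_approx:
  assumes "\<And>k u w. rapid u \<Longrightarrow> rapid w \<Longrightarrow> \<forall>\<^sub>F n in sequentially. \<exists>h.
    h \<in> OM_nhd complex_of_real k u \<and> h \<circ> \<psi> ^^ n \<in> OM_nhd (\<lambda>x. 0) k w"
  shows "tame {c..d}"
  unfolding tame_def
proof (intro allI impI poly_bounded_derivs_from_approx[OF smooth_iterate escaping_entry])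
  show "x \<in> entry {c..d} n \<Longrightarrow> (\<psi> ^^ n) x \<in> {c..d}" for n x
    by (simp add: entry_def)
  fix k w assume w: "rapid w"
  define R where "R = max \<bar>c\<bar> \<bar>d\<bar>"
  \<comment> \<open>The value 2 turns the threshold 1 into the error \<open>1 / 2\<close> on an
    interval containing \<open>[c, d]\<close>.\<close>
  let ?u = "\<lambda>x. if \<bar>x\<bar> \<le> R then 2 else (0::real)"
  define P where "P n h \<longleftrightarrow> h \<in> OM_nhd complex_of_real k ?u \<and> h \<circ> \<psi> ^^ n \<in> OM_nhd (\<lambda>x. 0) k w" for n h
  \<comment> \<open>The default 0 keeps \<open>H n\<close> smooth for the finitely many
    \<open>n\<close> without an approximant.\<close>
  define H where "H n = (if \<exists>h. P n h then SOME h. P n h else (\<lambda>x. 0))" for n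
  have PH: "P n (H n)" if "\<exists>h. P n h" for n
    using someI_ex[OF that] that by (simp add: H_def)
  have "smooth (H n)" for n
  proof (cases "\<exists>h. P n h")
    case True
    then show ?thesis
      using PH[OF True] by (auto simp: P_def OM_nhd_def intro: O_M_smooth)
  qed (simp add: H_def)
  moreover have "\<forall>\<^sub>F n in sequentially. \<exists>h. P n h"
    unfolding P_def by (intro assms rapid_indicator w) simp
  then have "\<forall>\<^sub>F n in sequentially. (\<forall>j\<le>k. \<forall>x. w x * norm (nderiv j (H n \<circ> \<psi> ^^ n) x) \<le> 1) \<and>
      (\<forall>j\<le>k. \<forall>y\<in>{c..d}. norm (nderiv j (H n) y - nderiv j complex_of_real y) \<le> 1 / 2)"
  proof (eventually_elim, intro conjI allI impI ballI)
    fix n j assume ex: "\<exists>h. P n h" and j: "j \<le> k"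
    then have H: "H n \<in> OM_nhd complex_of_real k ?u" "H n \<circ> \<psi> ^^ n \<in> OM_nhd (\<lambda>x. 0) k w"
      using PH[OF ex] by (auto simp: P_def)
    show "w x * norm (nderiv j (H n \<circ> \<psi> ^^ n) x) \<le> 1" for x
      using OM_nhdD[OF H(2) j, of x] by (simp add: o_def)
    fix y assume y: "y \<in> {c..d}"
    have "smooth (H n)" "smooth complex_of_real"
      using H(1) O_M_smooth[OF O_M_of_real[OF O_M_ident]] by (auto simp: OM_nhd_def intro: O_M_smooth)
    then have "nderiv j (H n) y - nderiv j complex_of_real y = nderiv j (\<lambda>x. H n x - complex_of_real x) y"
      by (simp add: nderiv_diff)
    moreover have "\<bar>y\<bar> \<le> R"
      using y by (auto simp: R_def)
    ultimately show "norm (nderiv j (H n) y - nderiv j complex_of_real y) \<le> 1 / 2"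
      using OM_nhdD[OF H(1) j, of y] by simp
  qed
  ultimately show "\<exists>H :: nat \<Rightarrow> real \<Rightarrow> complex. (\<forall>n. smooth (H n)) \<and>
      (\<forall>\<^sub>F n in sequentially. (\<forall>j\<le>k. \<forall>x. w x * norm (nderiv j (H n \<circ> \<psi> ^^ n) x) \<le> 1) \<and>
        (\<forall>j\<le>k. \<forall>y\<in>{c..d}. norm (nderiv j (H n) y - nderiv j complex_of_real y) \<le> 1 / 2))"
    by blast
qed

text \<open>Both halves come from mixing of the same operator. The pair (identity, 0) gives
  approximants for \<open>\<psi>\<close>; for the pair (0, identity) the function
  \<open>h \<circ> \<psi> ^^ n\<close> is one for \<open>\<kappa>\<close>, because composing it with
  \<open>\<kappa> ^^ n\<close> returns the small function \<open>h\<close>.\<close>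

lemma mixing_imp_tame:
  assumes "mixing OM_topology (comp_op \<psi>)"
  shows "tame {c..d}" and "free_diffeo.tame \<kappa> {c..d}"
proof -
  interpret s: free_diffeo \<kappa> \<psi> by (rule swap)
  note e = O_M_of_real[OF O_M_ident]
  show "tame {c..d}"
    by (rule tame_if_approx, rule mixing_nhds[OF assms e O_M_const])
  show "s.tame {c..d}"
  proof (rule s.tame_if_approx)
    fix k u w assume "rapid u" "rapid w"
    from mixing_nhds[OF assms O_M_const[of 0] e this(2,1), of k]
    show "\<forall>\<^sub>F n in sequentially. \<exists>h. h \<in> OM_nhd complex_of_real k u \<and> h \<circ> \<kappa> ^^ n \<in> OM_nhd (\<lambda>x. 0) k w"
    proof eventually_elim
      case (elim n)
      then obtain h where h: "h \<in> OM_nhd (\<lambda>x. 0) k w" "h \<circ> \<psi> ^^ n \<in> OM_nhd complex_of_real k u"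
        by blast
      moreover have "(h \<circ> \<psi> ^^ n) \<circ> \<kappa> ^^ n = h"
        by (auto simp: iterate_inverse)
      ultimately show ?case
        by metis
    qed
  qed
qed

lemma inv_iterate_eq: "inv_iterate \<psi> n = \<kappa> ^^ n"
  unfolding inv_iterate_def by (rule inv_equality) (simp_all add: iterate_inverse)

lemma vanishing_eq:
  "vanishing a \<longleftrightarrow> (\<forall>k\<ge>1. \<forall>v\<in>schwartz.
    (\<lambda>n. SUP x\<in>inv_iterate \<psi> n ` {min a (\<psi> a)..max a (\<psi> a)}.
      norm (v x * of_real (nderiv k (\<psi> ^^ n) x))) \<longlonglongrightarrow> 0)"
  unfolding vanishing_def entry_eq_image inv_iterate_eq ..

text \<open>The base point is \<open>\<psi> b\<close> because the segment of \<open>\<kappa>\<close>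
  there joins \<open>\<psi> b\<close> to \<open>\<kappa> (\<psi> b) = b\<close>, the interval of the
  second limit condition.\<close>

lemma swap_vanishing_eq:
  "free_diffeo.vanishing \<kappa> (\<psi> b) \<longleftrightarrow> (\<forall>k\<ge>1. \<forall>v\<in>schwartz.
    (\<lambda>n. SUP x\<in>(\<psi> ^^ n) ` {min b (\<psi> b)..max b (\<psi> b)}.
      norm (v x * of_real (nderiv k (inv_iterate \<psi> n) x))) \<longlonglongrightarrow> 0)"
proof -
  interpret s: free_diffeo \<kappa> \<psi> by (rule swap)
  have "s.segment (\<psi> b) = {min b (\<psi> b)..max b (\<psi> b)}"
    by (simp add: inverse min.commute max.commute)
  then show ?thesis
    unfolding s.vanishing_def s.entry_eq_image inv_iterate_eq by (simp only:)
qed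

text \<open>One circle proves both: mixing gives tameness of all intervals, hence the conditions for
  every \<open>a\<close>, hence for some pair, and any pair gives mixing.\<close>

lemma mixing_iff_vanishing:
  assumes "\<psi> \<in> O_M"
  shows "mixing OM_topology (comp_op \<psi>) \<longleftrightarrow>
      (\<forall>a. vanishing a \<and> free_diffeo.vanishing \<kappa> (\<psi> a))"
    and "mixing OM_topology (comp_op \<psi>) \<longleftrightarrow>
      (\<exists>a b. vanishing a \<and> free_diffeo.vanishing \<kappa> (\<psi> b))"
proof -
  interpret s: free_diffeo \<kappa> \<psi> by (rule swap)
  have "vanishing a \<and> s.vanishing (\<psi> a)" if "mixing OM_topology (comp_op \<psi>)" for a
    unfolding vanishing_iff_tame s.vanishing_iff_tame using mixing_imp_tame[OF that] by blast
  moreover have "mixing OM_topology (comp_op \<psi>)" if "vanishing a" "s.vanishing (\<psi> b)" for a b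
    using mixing_if_tame[OF assms] that unfolding vanishing_iff_tame s.vanishing_iff_tame by simp
  ultimately show "mixing OM_topology (comp_op \<psi>) \<longleftrightarrow> (\<forall>a. vanishing a \<and> s.vanishing (\<psi> a))"
    and "mixing OM_topology (comp_op \<psi>) \<longleftrightarrow> (\<exists>a b. vanishing a \<and> s.vanishing (\<psi> b))"
    by blast+
qed

end

section \<open>From surjective symbols to free diffeomorphisms\<close>

lemma deriv_eq_nderiv:
  fixes \<psi> :: "real \<Rightarrow> real"
  assumes "smooth \<psi>"
  shows "deriv \<psi> x = nderiv 1 \<psi> x"
  using smooth_has_vector_derivative0[OF assms, of x]
  by (intro DERIV_imp_deriv) (simp only: has_real_derivative_iff_has_vector_derivative)

lemma free_diffeoI:
  assumes sm: "smooth \<psi>" and "surj \<psi>" and "inj \<psi>" and "\<And>x. deriv \<psi> x \<noteq> 0" and "\<And>x. \<psi> x \<noteq> x"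
  shows "free_diffeo \<psi> (inv \<psi>)"
proof
  show inv: "inv \<psi> (\<psi> x) = x" "\<psi> (inv \<psi> x) = x" for x
    using assms by (simp_all add: surj_f_inv_f)
  have cont: "isCont \<psi> z" for z
    using smooth_continuous[OF sm, of UNIV] by (simp add: continuous_on_eq_continuous_at)
  have "isCont (inv \<psi>) (\<psi> x)" for x
    by (rule isCont_inverse_function[where d = 1]) (simp_all add: inv cont)
  from this[of "inv \<psi> _"] have "isCont (inv \<psi>) y" for y
    by (simp add: inv)
  then show "smooth (inv \<psi>)"
    using assms inv deriv_eq_nderiv[OF sm] by (intro smooth_inverse_function[OF sm]) auto
qed (use assms in auto)

theorem theorem7:
  fixes \<psi> :: "real \<Rightarrow> real"
  assumes "\<psi> \<in> O_M" and "surj \<psi>"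
  shows
    "(mixing OM_topology (comp_op \<psi>)
      \<longleftrightarrow>
      (inj \<psi> \<and> (\<forall>x. deriv \<psi> x \<noteq> 0) \<and> (\<forall>x. \<psi> x \<noteq> x) \<and>
       (\<forall>a. \<forall>k\<ge>1. \<forall>v\<in>schwartz.
          (\<lambda>n. SUP x\<in>inv_iterate \<psi> n ` {min a (\<psi> a)..max a (\<psi> a)}.
                 norm (v x * of_real (nderiv k (\<psi> ^^ n) x))) \<longlonglongrightarrow> 0 \<and>
          (\<lambda>n. SUP x\<in>(\<psi> ^^ n) ` {min a (\<psi> a)..max a (\<psi> a)}.
                 norm (v x * of_real (nderiv k (inv_iterate \<psi> n) x))) \<longlonglongrightarrow> 0)))
     \<and>
     (mixing OM_topology (comp_op \<psi>)
      \<longleftrightarrow>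
      (inj \<psi> \<and> (\<forall>x. deriv \<psi> x \<noteq> 0) \<and> (\<forall>x. \<psi> x \<noteq> x) \<and>
       (\<exists>a b. \<forall>k\<ge>1. \<forall>v\<in>schwartz.
          (\<lambda>n. SUP x\<in>inv_iterate \<psi> n ` {min a (\<psi> a)..max a (\<psi> a)}.
                 norm (v x * of_real (nderiv k (\<psi> ^^ n) x))) \<longlonglongrightarrow> 0 \<and>
          (\<lambda>n. SUP x\<in>(\<psi> ^^ n) ` {min b (\<psi> b)..max b (\<psi> b)}.
                 norm (v x * of_real (nderiv k (inv_iterate \<psi> n) x))) \<longlonglongrightarrow> 0)))"
proof (cases "inj \<psi> \<and> (\<forall>x. deriv \<psi> x \<noteq> 0) \<and> (\<forall>x. \<psi> x \<noteq> x)")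
  case True
  note sm = O_M_smooth[OF assms(1)]
  interpret free_diffeo \<psi> "inv \<psi>"
    using True assms sm by (intro free_diffeoI) auto
  \<comment> \<open>The theorem puts both limits under common quantifiers; separated, each is the
    \<open>vanishing\<close> predicate of one of the two maps.\<close>
  have split: "(\<forall>k\<ge>1. \<forall>v\<in>schwartz. P k v \<and> Q k v) \<longleftrightarrow>
      (\<forall>k\<ge>1. \<forall>v\<in>schwartz. P k v) \<and> (\<forall>k\<ge>1. \<forall>v\<in>schwartz. Q k v)"
    for P Q :: "nat \<Rightarrow> (real \<Rightarrow> complex) \<Rightarrow> bool"
    by blast
  show ?thesis
    unfolding split vanishing_eq[symmetric] swap_vanishing_eq[symmetric]
    using True mixing_iff_vanishing[OF assms(1)] by simp
next
  case False
  then have "\<not> mixing OM_topology (comp_op \<psi>)"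
    using mixing_inj mixing_deriv_nonzero mixing_no_fixed_point O_M_smooth[OF assms(1)]
      deriv_eq_nderiv by metis
  then show ?thesis
    using False by blast
qed

end
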